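(* Every $3$-dimensional indecomposable $\mathcal{B}$-module is isomorphic either to $\Bbbk^3_\lambda$ for a unique $\lambda\in\Bbbk$, or else to a representation in one of the families $\Theta_1,\Theta_2,\Theta_3,\Theta_4$, with the following constraints (which are exactly the conditions for a representation in the family to be indecomposable): the representations in $\Theta_1$ and in $\Theta_3$ are always indecomposable, so there is no further constraint for these families; a representation in $\Theta_2$ is indecomposable if and only if ($c\neq 0$ and $e=a$) or ($d\neq 0$ and $e=a$); a representation in $\Theta_4$ is indecomposable if and only if ($c\neq 0$ and $e=a$) or ($d\neq 0$ and $e=-a$). The isomorphism classes are described as follows. (1) Every $3$-dimensional indecomposable representation in $\Theta_1$ is isomorphic either to $\mathcal{U}^{a,b}$ or to $\mathcal{Y}_{a,b,c,d,e}$. Moreover, $\mathcal{Y}_{a,b,c,d,e}\simeq\mathcal{Y}_{a,b',c',d',e'}$ if and only if $$(a-d')\frac{ce'-c'e}{e'}=e(b'-b)+c(d'-d).$$ In particular, $\mathcal{U}^{a,b}\simeq\mathcal{U}^{a,b'}$ if and only if $b=b'$. (2) Every $3$-dimensional indecomposable representation in $\Theta_2$ is isomorphic either to $\mathcal{R}_a$, or to $\mathcal{S}_a$, or to $\mathcal{T}_{a,b,c}$. Moreover, $\mathcal{T}_{a,b,c}$ and $\mathcal{T}_{a,b',c'}$ are isomorphic if and only if $bc=b'c'$. (3) Every $3$-dimensional indecomposable representation in $\Theta_3$ is isomorphic either to $\mathcal{U}_{a,b}$ or to $\mathcal{W}_{a,b,c,d,e}$. Moreover, $\mathcal{W}_{a,b,c,d,e}\simeq\mathcal{W}_{a',b',c,d',e'}$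 if and only if $$\frac{ae-bd-ce}{d}=\frac{a'e'-b'd'-ce'}{d'}.$$ In particular, $\mathcal{U}_{a,b}\simeq\mathcal{U}_{a,b'}$ if and only if $b=b'$. (4) Every $3$-dimensional indecomposable representation in $\Theta_4$ is isomorphic either to $\mathcal{V}^a$ or to $\mathcal{V}_a$ for a unique $a\in\Bbbk^\times$.
   Context: $\Bbbk$ is an algebraically closed field of characteristic $0$ and $\Bbbk^\times=\Bbbk\setminus\{0\}$. The super Jordan plane $\mathcal{B}$ is the associative unital $\Bbbk$-algebra generated by $x_1,x_2$ with defining relations $x_1^2=0$ and $x_2x_{21}=x_{21}x_2+x_1x_{21}$, where $x_{21}:=x_1x_2+x_2x_1$. Write $X_1,X_2$ for the $3\times 3$ matrices by which $x_1,x_2$ act on $\Bbbk^3$. $\Bbbk^3_\lambda$ is the module with $X_1=0$ and $X_2$ the Jordan block of size $3$ with eigenvalue $\lambda$. In all other modules below $X_1=E_{12}$ (the matrix with entry $1$ in position $(1,2)$ and $0$ elsewhere), and $X_2$ is as follows, with $a,b,c,d,e\in\Bbbk$ subject to the stated restrictions (primed parameters are subject to the same restrictions as the unprimed ones): $\Theta_1$ (with $e\in\Bbbk^\times$): $X_2=\begin{pmatrix}a&b&c\\0&d&e\\0&\frac{a^2-d^2}{e}&-d\end{pmatrix}$, denoted $\mathcal{Y}_{a,b,c,d,e}$; and $\mathcal{U}^{a,b}:=\mathcal{Y}_{a,b,0,a,1}$, i.e. $X_2=\begin{pmatrix}a&b&0\\0&a&1\\0&0&-a\end{pmatrix}$.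 $\Theta_2$: $X_2=\begin{pmatrix}a&b&c\\0&a&0\\0&d&e\end{pmatrix}$. In this family, $\mathcal{R}_a$: $X_2=\begin{pmatrix}a&0&0\\0&a&0\\0&1&a\end{pmatrix}$; $\mathcal{S}_a$: $X_2=\begin{pmatrix}a&0&1\\0&a&0\\0&0&a\end{pmatrix}$; $\mathcal{T}_{a,b,c}$, for $b\in\Bbbk^\times$ or $c\in\Bbbk^\times$: $X_2=\begin{pmatrix}a&0&b\\0&a&0\\0&c&a\end{pmatrix}$. Thus $\mathcal{R}_a=\mathcal{T}_{a,0,1}$ and $\mathcal{S}_a=\mathcal{T}_{a,1,0}$. $\Theta_3$ (with $d\in\Bbbk^\times$): $X_2=\begin{pmatrix}a&b&\frac{c^2-a^2}{d}\\0&c&0\\d&e&-a\end{pmatrix}$, denoted $\mathcal{W}_{a,b,c,d,e}$; and $\mathcal{U}_{a,b}:=\mathcal{W}_{a,b,a,1,0}$, i.e. $X_2=\begin{pmatrix}a&b&0\\0&a&0\\1&0&-a\end{pmatrix}$. $\Theta_4$ (with $a\in\Bbbk^\times$): $X_2=\begin{pmatrix}a&b&c\\0&-a&0\\0&d&e\end{pmatrix}$. In this family, for $a\in\Bbbk^\times$, $\mathcal{V}^a$: $X_2=\begin{pmatrix}a&0&1\\0&-a&0\\0&0&a\end{pmatrix}$; $\mathcal{V}_a$: $X_2=\begin{pmatrix}a&0&0\\0&-a&0\\0&1&-a\end{pmatrix}$.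
   Formalization: Two printed criteria are false and are corrected: in (1) the last term is c(d−d') instead of c(d'−d); in (2) T_{a,b,c}≃T_{a,b',c'} iff bc=b'c' and also b=0⇔b'=0 and c=0⇔c'=0, since otherwise R_a and S_a (both with bc=0) would be isomorphic. *)

theory Defs
  imports "HOL-Analysis.Analysis" "HOL-Library.Poly_Mapping"
    "HOL-Computational_Algebra.Polynomial"
begin

section \<open>The super Jordan plane\<close>

text \<open>The free associative algebra on two generators is the monoid algebra of the free monoid
  of words. The monoid is written additively, as the library's convolution product on
  \<open>Poly_Mapping\<close> requires; its addition is concatenation.\<close>

datatype gen = G1 | G2

datatype gword = Word (letters: "gen list")

instantiation gword :: monoid_add
begin
definition zero_gword :: gword where "0 = Word []"
definition plus_gword :: "gword \<Rightarrow> gword \<Rightarrow> gword" where "u + v = Word (letters u @ letters v)"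
instance by standard (auto simp: zero_gword_def plus_gword_def)
end

type_synonym 'k free_alg = "gword \<Rightarrow>\<^sub>0 'k"

definition free_gen :: "gen \<Rightarrow> 'k::field free_alg" where
  "free_gen g = Poly_Mapping.single (Word [g]) 1"

definition two_sided_ideal :: "'r::ring_1 set \<Rightarrow> bool" where
  "two_sided_ideal I \<longleftrightarrow> 0 \<in> I \<and> (\<forall>f\<in>I. \<forall>g\<in>I. f + g \<in> I) \<and>
     (\<forall>a. \<forall>f\<in>I. a * f \<in> I \<and> f * a \<in> I)"

definition ideal_generated_by :: "'r::ring_1 set \<Rightarrow> 'r set" where
  "ideal_generated_by S = \<Inter> {I. two_sided_ideal I \<and> S \<subseteq> I}"

definition sjp_relators :: "'k::field free_alg set" where
  "sjp_relators =
    (let x1 = free_gen G1; x2 = free_gen G2; x21 = x2 * x1 + x1 * x2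
     in {x1 * x1, x2 * x21 - (x21 * x2 + x1 * x21)})"

lemma two_sided_ideal_generated: "two_sided_ideal (ideal_generated_by S)"
  by (auto simp: two_sided_ideal_def ideal_generated_by_def)

lemma subset_ideal_generated: "S \<subseteq> ideal_generated_by S"
  by (auto simp: ideal_generated_by_def)

definition sjp_cong :: "'k::field free_alg \<Rightarrow> 'k free_alg \<Rightarrow> bool" where
  "sjp_cong f g \<longleftrightarrow> f - g \<in> ideal_generated_by sjp_relators"

lemma two_sided_ideal_uminus: "two_sided_ideal I \<Longrightarrow> f \<in> I \<Longrightarrow> - f \<in> I"
  by (metis mult_minus1 two_sided_ideal_def)

lemma equivp_sjp_cong: "equivp sjp_cong"
proof (rule equivpI)
  let ?I = "ideal_generated_by (sjp_relators :: 'a free_alg set)"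
  have I: "two_sided_ideal ?I" by (rule two_sided_ideal_generated)
  show "reflp (sjp_cong :: 'a free_alg \<Rightarrow> _)"
    using I by (auto simp: reflp_def sjp_cong_def two_sided_ideal_def)
  show "symp (sjp_cong :: 'a free_alg \<Rightarrow> _)"
  proof (rule sympI)
    fix f g :: "'a free_alg"
    assume "sjp_cong f g"
    then have "- (f - g) \<in> ?I" using two_sided_ideal_uminus[OF I] by (simp only: sjp_cong_def)
    then show "sjp_cong g f" by (simp add: sjp_cong_def)
  qed
  show "transp (sjp_cong :: 'a free_alg \<Rightarrow> _)"
  proof (rule transpI)
    fix f g h :: "'a free_alg"
    assume "sjp_cong f g" "sjp_cong g h"
    then have "(f - g) + (g - h) \<in> ?I" using I unfolding two_sided_ideal_def sjp_cong_def by blast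
    then show "sjp_cong f h" by (simp add: sjp_cong_def)
  qed
qed

quotient_type (overloaded) 'k sjp = "'k::field free_alg" / sjp_cong
  by (rule equivp_sjp_cong)

instantiation sjp :: (field) ring_1
begin

lift_definition zero_sjp :: "'a sjp" is 0 .
lift_definition one_sjp :: "'a sjp" is 1 .

lift_definition plus_sjp :: "'a sjp \<Rightarrow> 'a sjp \<Rightarrow> 'a sjp" is "(+)"
proof -
  fix f f' g g' :: "'a free_alg"
  assume "sjp_cong f f'" "sjp_cong g g'"
  then have "(f - f') + (g - g') \<in> ideal_generated_by sjp_relators"
    using two_sided_ideal_generated unfolding two_sided_ideal_def sjp_cong_def by blast
  then show "sjp_cong (f + g) (f' + g')" by (simp add: sjp_cong_def algebra_simps)
qed

lift_definition uminus_sjp :: "'a sjp \<Rightarrow> 'a sjp" is uminus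
proof -
  fix f f' :: "'a free_alg"
  assume "sjp_cong f f'"
  then have "- (f - f') \<in> ideal_generated_by sjp_relators"
    using two_sided_ideal_uminus[OF two_sided_ideal_generated] unfolding sjp_cong_def by blast
  then show "sjp_cong (- f) (- f')" by (simp add: sjp_cong_def algebra_simps)
qed

lift_definition minus_sjp :: "'a sjp \<Rightarrow> 'a sjp \<Rightarrow> 'a sjp" is "(-)"
proof -
  fix f f' g g' :: "'a free_alg"
  assume "sjp_cong f f'" "sjp_cong g g'"
  then have "(f - f') + - (g - g') \<in> ideal_generated_by sjp_relators"
    using two_sided_ideal_generated two_sided_ideal_uminus[OF two_sided_ideal_generated]
    unfolding two_sided_ideal_def sjp_cong_def by blast
  then show "sjp_cong (f - g) (f' - g')" by (simp add: sjp_cong_def algebra_simps)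
qed

lift_definition times_sjp :: "'a sjp \<Rightarrow> 'a sjp \<Rightarrow> 'a sjp" is "(*)"
proof -
  fix f f' g g' :: "'a free_alg"
  assume "sjp_cong f f'" "sjp_cong g g'"
  then have "(f - f') * g + f' * (g - g') \<in> ideal_generated_by sjp_relators"
    using two_sided_ideal_generated unfolding two_sided_ideal_def sjp_cong_def by blast
  then show "sjp_cong (f * g) (f' * g')" by (simp add: sjp_cong_def algebra_simps)
qed

lemma one_notin_sjp_ideal: "(1 :: 'a free_alg) \<notin> ideal_generated_by sjp_relators"
proof -
  let ?J = "{f :: 'a free_alg. Poly_Mapping.lookup f 0 = 0}"
  have sum0: "u + v = 0 \<longleftrightarrow> u = 0 \<and> v = 0" for u v :: gword
    by (cases u; cases v) (auto simp: zero_gword_def plus_gword_def)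
  have lookup_mult_0: "Poly_Mapping.lookup (f * g) 0 = Poly_Mapping.lookup f 0 * Poly_Mapping.lookup g 0"
    for f g :: "'a free_alg"
  proof -
    have "Poly_Mapping.lookup (f * g) 0 = prod_fun (Poly_Mapping.lookup f) (Poly_Mapping.lookup g) 0"
      by (simp add: times_poly_mapping.rep_eq)
    also have "\<dots> = (\<Sum>(a, b). Poly_Mapping.lookup f a * Poly_Mapping.lookup g b when 0 = a + b)"
      by (rule prod_fun_unfold_prod) simp_all
    also have "\<dots> = (\<Sum>p. Poly_Mapping.lookup f (fst p) * Poly_Mapping.lookup g (snd p) when p = (0, 0))"
      by (rule arg_cong[where f = Sum_any])
        (auto simp: fun_eq_iff when_def sum0 eq_commute[of 0])
    finally show ?thesis by simp
  qed
  have lookup_gen_0: "Poly_Mapping.lookup (free_gen g :: 'a free_alg) 0 = 0" for g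
    by (simp add: free_gen_def lookup_single zero_gword_def)
  have "two_sided_ideal ?J"
    by (auto simp: two_sided_ideal_def lookup_add lookup_mult_0)
  moreover have "sjp_relators \<subseteq> ?J"
    by (auto simp: sjp_relators_def Let_def lookup_add lookup_minus lookup_mult_0 lookup_gen_0)
  ultimately have "ideal_generated_by sjp_relators \<subseteq> ?J"
    by (auto simp: ideal_generated_by_def)
  then show ?thesis by auto
qed

instance
proof
  show "(0 :: 'a sjp) \<noteq> 1"
  proof (transfer, rule notI)
    assume "sjp_cong (0 :: 'a free_alg) 1"
    then have "- (0 - 1) \<in> ideal_generated_by (sjp_relators :: 'a free_alg set)"
      using two_sided_ideal_uminus[OF two_sided_ideal_generated] unfolding sjp_cong_def by blast
    then show False using one_notin_sjp_ideal by simp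
  qed
qed (transfer; simp add: equivp_reflp[OF equivp_sjp_cong] algebra_simps)+

end

lift_definition sjp_gen :: "gen \<Rightarrow> 'k::field sjp" is free_gen .

lift_definition sjp_scalar :: "'k::field \<Rightarrow> 'k sjp" is "Poly_Mapping.single 0" .


section \<open>Modules\<close>

text \<open>The library's locale \<open>module\<close> is restricted to commutative rings.\<close>

locale left_module =
  fixes act :: "'r::ring_1 \<Rightarrow> 'v::ab_group_add \<Rightarrow> 'v"
  assumes act_add_right: "act r (v + w) = act r v + act r w"
    and act_add_left: "act (r + s) v = act r v + act s v"
    and act_act: "act r (act s v) = act (r * s) v"
    and act_one: "act 1 v = v"

definition submodule :: "('r::ring_1 \<Rightarrow> 'v::ab_group_add \<Rightarrow> 'v) \<Rightarrow> 'v set \<Rightarrow> bool" where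
  "submodule act U \<longleftrightarrow> 0 \<in> U \<and> (\<forall>u\<in>U. \<forall>v\<in>U. u + v \<in> U) \<and> (\<forall>r. \<forall>u\<in>U. act r u \<in> U)"

definition indecomposable :: "('r::ring_1 \<Rightarrow> 'v::ab_group_add \<Rightarrow> 'v) \<Rightarrow> bool" where
  "indecomposable act \<longleftrightarrow> left_module act \<and> (UNIV :: 'v set) \<noteq> {0} \<and>
     (\<forall>U W. submodule act U \<and> submodule act W \<and> U \<inter> W = {0} \<and> (\<forall>v. \<exists>u\<in>U. \<exists>w\<in>W. v = u + w)
        \<longrightarrow> U = {0} \<or> W = {0})"

definition module_iso ::
  "('r::ring_1 \<Rightarrow> 'v::ab_group_add \<Rightarrow> 'v) \<Rightarrow> ('r \<Rightarrow> 'w::ab_group_add \<Rightarrow> 'w) \<Rightarrow> bool"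
  (infix "\<simeq>\<^sub>M" 50) where
  "act \<simeq>\<^sub>M act' \<longleftrightarrow> left_module act \<and> left_module act' \<and>
     (\<exists>\<phi>. bij \<phi> \<and> (\<forall>u v. \<phi> (u + v) = \<phi> u + \<phi> v) \<and> (\<forall>r v. \<phi> (act r v) = act' r (\<phi> v)))"

text \<open>The dimension of a module over the algebra is that of the underlying vector space, on which
  a scalar \<open>c\<close> acts as \<open>c \<cdot> 1\<close>. The library's \<open>dim\<close> is 0 for spaces of infinite dimension.\<close>

definition sjp_dim :: "('k::field sjp \<Rightarrow> 'v::ab_group_add \<Rightarrow> 'v) \<Rightarrow> nat" where
  "sjp_dim act = vector_space.dim (\<lambda>c. act (sjp_scalar c)) UNIV"


section \<open>Modules given by a pair of matrices\<close>

fun word_act :: "'k::field^3^3 \<Rightarrow> 'k^3^3 \<Rightarrow> gen list \<Rightarrow> 'k^3 \<Rightarrow> 'k^3" where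
  "word_act X1 X2 [] v = v"
| "word_act X1 X2 (G1 # w) v = X1 *v word_act X1 X2 w v"
| "word_act X1 X2 (G2 # w) v = X2 *v word_act X1 X2 w v"

definition free_act :: "'k::field^3^3 \<Rightarrow> 'k^3^3 \<Rightarrow> 'k free_alg \<Rightarrow> 'k^3 \<Rightarrow> 'k^3" where
  "free_act X1 X2 f v =
     (\<Sum>w\<in>Poly_Mapping.keys f. Poly_Mapping.lookup f w *s word_act X1 X2 (letters w) v)"

text \<open>An element of the quotient acts through a representative. If the matrices satisfy the
  defining relations, the choice does not matter and this is a module on which the generators act
  by the given matrices: see \<open>free_act_cong\<close>, \<open>left_module_mat_module\<close> and \<open>mat_module_gen\<close> below.\<close>

definition mat_module :: "'k::field^3^3 \<Rightarrow> 'k^3^3 \<Rightarrow> 'k sjp \<Rightarrow> 'k^3 \<Rightarrow> 'k^3" where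
  "mat_module X1 X2 b v = free_act X1 X2 (rep_sjp b) v"

definition sjp_relations :: "'k::field^3^3 \<Rightarrow> 'k^3^3 \<Rightarrow> bool" where
  "sjp_relations X1 X2 \<longleftrightarrow> X1 ** X1 = 0 \<and>
     (let X21 = X2 ** X1 + X1 ** X2 in X2 ** X21 = X21 ** X2 + X1 ** X21)"

lemma word_act_append: "word_act X1 X2 (u @ w) v = word_act X1 X2 u (word_act X1 X2 w v)"
  by (induction X1 X2 u v rule: word_act.induct) auto

lemma word_act_add: "word_act X1 X2 u (v + w) = word_act X1 X2 u v + word_act X1 X2 u w"
  by (induction X1 X2 u v rule: word_act.induct) (auto simp: matrix_vector_right_distrib)

lemma word_act_scale: "word_act X1 X2 u (c *s v) = c *s word_act X1 X2 u v"
  by (induction X1 X2 u v rule: word_act.induct) (auto simp: vector_scalar_commute)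

lemma free_act_superset:
  assumes "finite A" "Poly_Mapping.keys f \<subseteq> A"
  shows "free_act X1 X2 f v = (\<Sum>w\<in>A. Poly_Mapping.lookup f w *s word_act X1 X2 (letters w) v)"
  unfolding free_act_def using assms
  by (intro sum.mono_neutral_left) (auto simp: in_keys_iff)

lemma free_act_add_left: "free_act X1 X2 (f + g) v = free_act X1 X2 f v + free_act X1 X2 g v"
proof -
  let ?A = "Poly_Mapping.keys f \<union> Poly_Mapping.keys g"
  show ?thesis
    using keys_add[of f g]
    by (simp add: free_act_superset[of ?A] lookup_add vector_sadd_rdistrib sum.distrib)
qed

lemma free_act_zero: "free_act X1 X2 0 v = 0"
  by (simp add: free_act_def)

lemma free_act_uminus: "free_act X1 X2 (- f) v = - free_act X1 X2 f v"
  using free_act_add_left[of X1 X2 f "- f" v] by (simp add: free_act_zero eq_neg_iff_add_eq_0 add.commute)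

lemma free_act_diff: "free_act X1 X2 (f - g) v = free_act X1 X2 f v - free_act X1 X2 g v"
  using free_act_add_left[of X1 X2 f "- g" v] by (simp add: free_act_uminus)

lemma free_act_add_right: "free_act X1 X2 f (v + w) = free_act X1 X2 f v + free_act X1 X2 f w"
  by (simp add: free_act_def word_act_add vec.scale_right_distrib sum.distrib)

lemma free_act_zero_right: "free_act X1 X2 f 0 = 0"
  using free_act_add_right[of X1 X2 f 0 0] by simp

lemma free_act_single:
  "free_act X1 X2 (Poly_Mapping.single w c) v = c *s word_act X1 X2 (letters w) v"
  by (simp add: free_act_def)

lemma free_act_single_scale:
  "free_act X1 X2 (Poly_Mapping.single w c) (d *s v) = d *s free_act X1 X2 (Poly_Mapping.single w c) v"
  by (simp add: free_act_single word_act_scale mult.commute)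

lemma free_alg_induct [case_names zero single add]:
  fixes f :: "'k::field free_alg"
  assumes "P 0" "\<And>w c. P (Poly_Mapping.single w c)" "\<And>f g. P f \<Longrightarrow> P g \<Longrightarrow> P (f + g)"
  shows "P f"
proof -
  have "P (\<Sum>w\<in>A. Poly_Mapping.single w (Poly_Mapping.lookup f w))" if "finite A" for A
    using that by (induction A rule: finite_induct) (auto intro: assms)
  moreover have "(\<Sum>w\<in>Poly_Mapping.keys f. Poly_Mapping.single w (Poly_Mapping.lookup f w)) = f"
    by (rule poly_mapping_eqI) (auto simp: lookup_sum lookup_single when_def in_keys_iff)
  ultimately show ?thesis by (metis finite_keys)
qed

lemma free_act_mult: "free_act X1 X2 (f * g) v = free_act X1 X2 f (free_act X1 X2 g v)"
proof (induction f rule: free_alg_induct)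
  case zero
  then show ?case by (simp add: free_act_zero)
next
  case (single w c)
  show ?case
  proof (induction g rule: free_alg_induct)
    case zero
    then show ?case by (simp add: free_act_zero free_act_zero_right)
  next
    case (single u d)
    then show ?case
      by (simp add: mult_single free_act_single plus_gword_def word_act_append word_act_scale)
  next
    case (add f g)
    then show ?case by (simp add: distrib_left free_act_add_left free_act_add_right)
  qed
next
  case (add f g)
  then show ?case by (simp add: distrib_right free_act_add_left)
qed

lemma free_act_gen:
  "free_act X1 X2 (free_gen G1) v = X1 *v v" "free_act X1 X2 (free_gen G2) v = X2 *v v"
  by (simp_all add: free_gen_def free_act_single)

lemma free_act_cong:
  assumes "sjp_relations X1 X2" "sjp_cong f g"
  shows "free_act X1 X2 f v = free_act X1 X2 g v"
proof -
  let ?J = "{f. \<forall>v. free_act X1 X2 f v = 0}"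
  have "two_sided_ideal ?J"
    by (auto simp: two_sided_ideal_def free_act_zero free_act_add_left free_act_mult
        free_act_zero_right)
  moreover have "sjp_relators \<subseteq> ?J"
  proof -
    have 1: "X1 *v (X1 *v v) = 0" for v
      using assms(1) by (simp add: sjp_relations_def matrix_vector_mul_assoc)
    have 2: "(X2 ** (X2 ** X1 + X1 ** X2)) *v v =
        ((X2 ** X1 + X1 ** X2) ** X2 + X1 ** (X2 ** X1 + X1 ** X2)) *v v" for v
      using assms(1) by (simp add: sjp_relations_def Let_def)
    show ?thesis
      using 1 2
      by (auto simp: sjp_relators_def Let_def free_act_diff free_act_add_left free_act_mult
          free_act_gen simp flip: matrix_vector_mul_assoc simp: matrix_vector_mult_add_rdistrib)
  qed
  ultimately have "ideal_generated_by sjp_relators \<subseteq> ?J"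
    by (auto simp: ideal_generated_by_def)
  then have "free_act X1 X2 (f - g) v = 0"
    using assms(2) by (auto simp: sjp_cong_def)
  then show ?thesis by (simp add: free_act_diff)
qed

lemma mat_module_abs:
  assumes "sjp_relations X1 X2"
  shows "mat_module X1 X2 (abs_sjp f) v = free_act X1 X2 f v"
  unfolding mat_module_def
  by (rule free_act_cong[OF assms])
    (metis Quotient_sjp Quotient_rep_abs equivp_reflp equivp_sjp_cong)

lemma left_module_mat_module:
  assumes "sjp_relations X1 X2"
  shows "left_module (mat_module X1 X2)"
proof
  note abs = mat_module_abs[OF assms]
  fix r s :: "'a sjp" and v w :: "'a^3"
  obtain f where f: "r = abs_sjp f" by (metis Quotient_sjp Quotient_abs_rep)
  obtain g where g: "s = abs_sjp g" by (metis Quotient_sjp Quotient_abs_rep)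
  show "mat_module X1 X2 r (v + w) = mat_module X1 X2 r v + mat_module X1 X2 r w"
    by (simp add: f abs free_act_add_right)
  show "mat_module X1 X2 (r + s) v = mat_module X1 X2 r v + mat_module X1 X2 s v"
    by (simp add: f g abs plus_sjp.abs_eq free_act_add_left)
  show "mat_module X1 X2 r (mat_module X1 X2 s v) = mat_module X1 X2 (r * s) v"
    by (simp add: f g abs times_sjp.abs_eq free_act_mult)
  show "mat_module X1 X2 1 v = v"
    using free_act_single[of X1 X2 0 1 v] by (simp add: one_sjp_def abs) (simp add: zero_gword_def)
qed

lemma mat_module_gen:
  assumes "sjp_relations X1 X2"
  shows "mat_module X1 X2 (sjp_gen G1) v = X1 *v v" "mat_module X1 X2 (sjp_gen G2) v = X2 *v v"
  using mat_module_abs[OF assms] by (simp_all add: sjp_gen.abs_eq free_act_gen)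

lemma mat_module_scalar:
  assumes "sjp_relations X1 X2"
  shows "mat_module X1 X2 (sjp_scalar c) v = c *s v"
  using mat_module_abs[OF assms] by (simp add: sjp_scalar.abs_eq free_act_single zero_gword_def)


section \<open>The families\<close>

definition mat3 :: "'k \<Rightarrow> 'k \<Rightarrow> 'k \<Rightarrow> 'k \<Rightarrow> 'k \<Rightarrow> 'k \<Rightarrow> 'k \<Rightarrow> 'k \<Rightarrow> 'k \<Rightarrow> 'k::field^3^3" where
  "mat3 a11 a12 a13 a21 a22 a23 a31 a32 a33 =
     vector [vector [a11, a12, a13], vector [a21, a22, a23], vector [a31, a32, a33]]"

definition E12 :: "'k::field^3^3" where
  "E12 = mat3 0 1 0
              0 0 0
              0 0 0"

definition jordan_module :: "'k::field \<Rightarrow> 'k sjp \<Rightarrow> 'k^3 \<Rightarrow> 'k^3" where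
  "jordan_module l = mat_module 0 (mat3 l 1 0
                                        0 l 1
                                        0 0 l)"

definition Y_module :: "'k::field \<Rightarrow> 'k \<Rightarrow> 'k \<Rightarrow> 'k \<Rightarrow> 'k \<Rightarrow> 'k sjp \<Rightarrow> 'k^3 \<Rightarrow> 'k^3" where
  "Y_module a b c d e = mat_module E12 (mat3 a b c
                                             0 d e
                                             0 ((a^2 - d^2) / e) (- d))"

text \<open>The isomorphism condition for \<open>Y_module a b c d e\<close> and \<open>Y_module a b' c' d' e'\<close> contains
  the term \<open>c * (d - d')\<close>. The source prints \<open>c * (d' - d)\<close>, with which the pair
  \<open>(a, b, c, d, e) = (0, 0, 1, 0, 1)\<close>, \<open>(b', c', d', e') = (-2, 0, 1, 1)\<close> satisfies the condition,
  but the generator \<open>x\<^sub>2\<close> squares to zero on the first module only.\<close>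

definition upper_U :: "'k::field \<Rightarrow> 'k \<Rightarrow> 'k sjp \<Rightarrow> 'k^3 \<Rightarrow> 'k^3" where
  "upper_U a b = Y_module a b 0 a 1"

definition Theta1 :: "('k::field sjp \<Rightarrow> 'k^3 \<Rightarrow> 'k^3) set" where
  "Theta1 = {Y_module a b c d e | a b c d e. e \<noteq> 0}"

definition Theta2_module :: "'k::field \<Rightarrow> 'k \<Rightarrow> 'k \<Rightarrow> 'k \<Rightarrow> 'k \<Rightarrow> 'k sjp \<Rightarrow> 'k^3 \<Rightarrow> 'k^3" where
  "Theta2_module a b c d e = mat_module E12 (mat3 a b c
                                                  0 a 0
                                                  0 d e)"

definition Theta2 :: "('k::field sjp \<Rightarrow> 'k^3 \<Rightarrow> 'k^3) set" where
  "Theta2 = {Theta2_module a b c d e | a b c d e. True}"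

definition R_module :: "'k::field \<Rightarrow> 'k sjp \<Rightarrow> 'k^3 \<Rightarrow> 'k^3" where
  "R_module a = mat_module E12 (mat3 a 0 0
                                     0 a 0
                                     0 1 a)"

definition S_module :: "'k::field \<Rightarrow> 'k sjp \<Rightarrow> 'k^3 \<Rightarrow> 'k^3" where
  "S_module a = mat_module E12 (mat3 a 0 1
                                     0 a 0
                                     0 0 a)"

definition T_module :: "'k::field \<Rightarrow> 'k \<Rightarrow> 'k \<Rightarrow> 'k sjp \<Rightarrow> 'k^3 \<Rightarrow> 'k^3" where
  "T_module a b c = mat_module E12 (mat3 a 0 b
                                         0 a 0
                                         0 c a)"

text \<open>The product \<open>b * c\<close> classifies these modules when it is nonzero, but it does not separate
  \<open>R_module a = T_module a 0 1\<close> from \<open>S_module a = T_module a 1 0\<close>, where the common kernel of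
  \<open>x\<^sub>1\<close> and \<open>x\<^sub>2 - a\<close> has dimension 2 and 1 respectively. The isomorphism criterion valid for all
  admissible parameters therefore also records which of \<open>b\<close>, \<open>c\<close> vanish.\<close>

definition W_module :: "'k::field \<Rightarrow> 'k \<Rightarrow> 'k \<Rightarrow> 'k \<Rightarrow> 'k \<Rightarrow> 'k sjp \<Rightarrow> 'k^3 \<Rightarrow> 'k^3" where
  "W_module a b c d e = mat_module E12 (mat3 a b ((c^2 - a^2) / d)
                                             0 c 0
                                             d e (- a))"

definition lower_U :: "'k::field \<Rightarrow> 'k \<Rightarrow> 'k sjp \<Rightarrow> 'k^3 \<Rightarrow> 'k^3" where
  "lower_U a b = W_module a b a 1 0"

definition Theta3 :: "('k::field sjp \<Rightarrow> 'k^3 \<Rightarrow> 'k^3) set" where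
  "Theta3 = {W_module a b c d e | a b c d e. d \<noteq> 0}"

definition Theta4_module :: "'k::field \<Rightarrow> 'k \<Rightarrow> 'k \<Rightarrow> 'k \<Rightarrow> 'k \<Rightarrow> 'k sjp \<Rightarrow> 'k^3 \<Rightarrow> 'k^3" where
  "Theta4_module a b c d e = mat_module E12 (mat3 a b c
                                                  0 (- a) 0
                                                  0 d e)"

definition Theta4 :: "('k::field sjp \<Rightarrow> 'k^3 \<Rightarrow> 'k^3) set" where
  "Theta4 = {Theta4_module a b c d e | a b c d e. a \<noteq> 0}"

definition upper_V :: "'k::field \<Rightarrow> 'k sjp \<Rightarrow> 'k^3 \<Rightarrow> 'k^3" where
  "upper_V a = mat_module E12 (mat3 a 0 1
                                    0 (- a) 0
                                    0 0 a)"

definition lower_V :: "'k::field \<Rightarrow> 'k sjp \<Rightarrow> 'k^3 \<Rightarrow> 'k^3" where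
  "lower_V a = mat_module E12 (mat3 a 0 0
                                    0 (- a) 0
                                    0 1 (- a))"

lemmas mat3_relations_simps =
  sjp_relations_def mat3_def E12_def Let_def vec_eq_iff forall_3 matrix_matrix_mult_def sum_3

text \<open>All of these pairs of matrices satisfy the defining relations.\<close>

lemma sjp_relations_families:
  fixes a b c d e l :: "'k::field"
  shows "sjp_relations 0 (mat3 l 1 0 0 l 1 0 0 l)"
    and "e \<noteq> 0 \<Longrightarrow> sjp_relations E12 (mat3 a b c 0 d e 0 ((a^2 - d^2) / e) (- d))"
    and "sjp_relations E12 (mat3 a b c 0 a 0 0 d e)"
    and "d \<noteq> 0 \<Longrightarrow> sjp_relations E12 (mat3 a b ((c^2 - a^2) / d) 0 c 0 d e (- a))"
    and "sjp_relations E12 (mat3 a b c 0 (- a) 0 0 d e)"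
  by (simp_all add: mat3_relations_simps field_simps power2_eq_square)

end

theory Submission
  imports Defs
begin

text \<open>An isomorphism of matrix modules is an invertible intertwiner of the two pairs of matrices,
  and a matrix module is indecomposable iff no nontrivial idempotent matrix commutes with the pair.
  Since \<open>x\<^sub>1\<close> squares to zero, in dimension three it is zero or conjugate to \<open>E12\<close>. In the first
  case, indecomposability forces \<open>x\<^sub>2\<close> to be a single Jordan block: by Cayley--Hamilton, a singular
  translate \<open>x\<^sub>2 - l\<close> commutes with an explicit nontrivial idempotent unless its characteristic
  polynomial is a power of the variable. In the second case the relations leave exactly the four
  families, and what remains is the algebra of the matrices that commute with \<open>E12\<close>.\<close>


section \<open>Modules over the super Jordan plane\<close>

text \<open>A module is only an additive action of the quotient algebra on an abstract group, so
  linearity is never given: it comes from the scalars inside the algebra, which are central. The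
  matrices commuting with \<open>E12\<close> have the shape \<open>mat3 x y z 0 x 0 0 u v\<close>.
  Hence every isomorphism between modules with x1 = \<open>E12\<close> is a solution of polynomial
  equations in five unknowns with x and v nonzero. Existence is settled by setting x = 1 and solving
  the entries one at a time; necessity is an elimination. Algebraic closure enters through one
  eigenvalue of x2 when x1 acts by zero. Characteristic 0 enters in the family
  \<open>Theta4\<close>, where \<open>2 * a\<close> is a denominator and a has to differ from -a.
  The Jordan modules stay apart from the families because x1 acts on them by zero, and on the
  families by the nonzero matrix \<open>E12\<close>.\<close>

lemma sjp_abs_exhaust: obtains f where "r = abs_sjp f"
  by (metis Quotient_sjp Quotient_abs_rep)

text \<open>A representative is a sum of scaled words and a word is a product of generators.
  Identities between actions are stable under sums and products, so this rule reduces them to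
  scalars and generators.\<close>

lemma sjp_induct [case_names scalar gen add mult]:
  fixes r :: "'k::field sjp"
  assumes scalar: "\<And>c. P (sjp_scalar c)" and gen: "\<And>g. P (sjp_gen g)"
    and add: "\<And>r s. P r \<Longrightarrow> P s \<Longrightarrow> P (r + s)" and mult: "\<And>r s. P r \<Longrightarrow> P s \<Longrightarrow> P (r * s)"
  shows "P r"
proof -
  have word: "P (abs_sjp (Poly_Mapping.single (Word w) c))" for w c
  proof (induction w)
    case Nil
    then show ?case using scalar[of c] by (simp add: sjp_scalar.abs_eq zero_gword_def)
  next
    case (Cons g w)
    have "abs_sjp (Poly_Mapping.single (Word (g # w)) c) =
        sjp_gen g * abs_sjp (Poly_Mapping.single (Word w) c)"
      by (simp add: sjp_gen.abs_eq times_sjp.abs_eq free_gen_def mult_single plus_gword_def)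
    then show ?case using mult[OF gen Cons.IH] by simp
  qed
  obtain f where "r = abs_sjp f" by (rule sjp_abs_exhaust)
  moreover have "P (abs_sjp f)"
  proof (induction f rule: free_alg_induct)
    case zero
    then show ?case using scalar[of 0] by (simp add: sjp_scalar.abs_eq)
  next
    case (single w c)
    then show ?case using word[of "letters w" c] by simp
  next
    case (add f g)
    then show ?case using assms(3) by (metis plus_sjp.abs_eq)
  qed
  ultimately show ?thesis by simp
qed

lemma sjp_scalar_simps:
  "sjp_scalar (c + d) = sjp_scalar c + sjp_scalar d"
  "sjp_scalar (c * d) = sjp_scalar c * sjp_scalar d"
  "sjp_scalar 1 = (1 :: 'k::field sjp)"
  by (simp_all add: sjp_scalar.abs_eq plus_sjp.abs_eq times_sjp.abs_eq one_sjp_def single_add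
      mult_single)

text \<open>Centrality makes the generators act linearly for the vector space structure that the
  scalars put on an arbitrary module, so that they have matrices.\<close>

lemma sjp_scalar_central: "sjp_scalar c * r = r * sjp_scalar c" for r :: "'k::field sjp"
proof (induction r rule: sjp_induct)
  case (scalar d)
  then show ?case by (simp flip: sjp_scalar_simps add: mult.commute)
next
  case (gen g)
  then show ?case
    by (simp add: sjp_scalar.abs_eq sjp_gen.abs_eq times_sjp.abs_eq free_gen_def mult_single)
next
  case (add r s)
  then show ?case by (simp add: distrib_left distrib_right)
next
  case (mult r s)
  then show ?case by (metis mult.assoc)
qed

lemma sjp_gen_relations:
  fixes x1 x2 :: "'k::field sjp"
  defines "x1 \<equiv> sjp_gen G1" and "x2 \<equiv> sjp_gen G2"
  shows "x1 * x1 = 0"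
    and "x2 * (x2 * x1 + x1 * x2) = (x2 * x1 + x1 * x2) * x2 + x1 * (x2 * x1 + x1 * x2)"
proof -
  have abs_eqI: "abs_sjp f = abs_sjp g" if "f - g \<in> sjp_relators" for f g :: "'k free_alg"
    using that subset_ideal_generated[of sjp_relators]
    by (auto simp: sjp.abs_eq_iff sjp_cong_def)
  show "x1 * x1 = 0"
    unfolding assms sjp_gen.abs_eq times_sjp.abs_eq zero_sjp_def
    by (rule abs_eqI) (simp add: sjp_relators_def Let_def)
  show "x2 * (x2 * x1 + x1 * x2) = (x2 * x1 + x1 * x2) * x2 + x1 * (x2 * x1 + x1 * x2)"
    unfolding assms sjp_gen.abs_eq times_sjp.abs_eq plus_sjp.abs_eq
    by (rule abs_eqI) (simp add: sjp_relators_def Let_def)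
qed

section \<open>Isomorphisms of modules and their effect on indecomposability\<close>

lemma module_isoI:
  fixes act :: "'k::field sjp \<Rightarrow> 'v::ab_group_add \<Rightarrow> 'v"
    and act' :: "'k sjp \<Rightarrow> 'w::ab_group_add \<Rightarrow> 'w"
  assumes "left_module act" "left_module act'" "bij \<phi>"
    and add: "\<And>u v. \<phi> (u + v) = \<phi> u + \<phi> v"
    and scalar: "\<And>c v. \<phi> (act (sjp_scalar c) v) = act' (sjp_scalar c) (\<phi> v)"
    and gen: "\<And>g v. \<phi> (act (sjp_gen g) v) = act' (sjp_gen g) (\<phi> v)"
  shows "act \<simeq>\<^sub>M act'"
proof -
  interpret A: left_module act by fact
  interpret B: left_module act' by fact
  have "\<phi> (act r v) = act' r (\<phi> v)" for r v
    by (induction r arbitrary: v rule: sjp_induct)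
      (simp_all add: scalar gen add A.act_add_left B.act_add_left flip: A.act_act B.act_act)
  then show ?thesis using assms unfolding module_iso_def by blast
qed

lemma module_iso_refl: "left_module act \<Longrightarrow> act \<simeq>\<^sub>M act"
  unfolding module_iso_def by (metis bij_id id_apply)

lemma module_iso_sym:
  assumes "act \<simeq>\<^sub>M act'"
  shows "act' \<simeq>\<^sub>M act"
proof -
  obtain \<phi> where \<phi>: "bij \<phi>" "\<And>u v. \<phi> (u + v) = \<phi> u + \<phi> v" "\<And>r v. \<phi> (act r v) = act' r (\<phi> v)"
    using assms by (auto simp: module_iso_def)
  have [simp]: "\<phi> (inv \<phi> w) = w" for w by (simp add: \<phi>(1) bij_is_surj surj_f_inv_f)
  have inj: "\<phi> x = \<phi> y \<Longrightarrow> x = y" for x y by (metis \<phi>(1) bij_pointE)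
  have "bij (inv \<phi>)" by (simp add: \<phi>(1) bij_imp_bij_inv)
  moreover have "inv \<phi> (u + v) = inv \<phi> u + inv \<phi> v" for u v by (rule inj) (simp add: \<phi>)
  moreover have "inv \<phi> (act' r v) = act r (inv \<phi> v)" for r v by (rule inj) (simp add: \<phi>)
  ultimately show ?thesis using assms unfolding module_iso_def by blast
qed

lemma module_iso_trans:
  assumes "act \<simeq>\<^sub>M act'" "act' \<simeq>\<^sub>M act''"
  shows "act \<simeq>\<^sub>M act''"
proof -
  obtain \<phi> where \<phi>: "bij \<phi>" "\<And>u v. \<phi> (u + v) = \<phi> u + \<phi> v" "\<And>r v. \<phi> (act r v) = act' r (\<phi> v)"
    using assms(1) by (auto simp: module_iso_def)
  obtain \<psi> where \<psi>: "bij \<psi>" "\<And>u v. \<psi> (u + v) = \<psi> u + \<psi> v" "\<And>r v. \<psi> (act' r v) = act'' r (\<psi> v)"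
    using assms(2) by (auto simp: module_iso_def)
  have "bij (\<psi> \<circ> \<phi>)" using \<phi>(1) \<psi>(1) by (rule bij_comp)
  then show ?thesis
    using assms \<phi> \<psi> unfolding module_iso_def by (intro conjI exI[of _ "\<psi> \<circ> \<phi>"]) auto
qed

lemma module_iso_cong_left: "act \<simeq>\<^sub>M act' \<Longrightarrow> act \<simeq>\<^sub>M act'' \<longleftrightarrow> act' \<simeq>\<^sub>M act''"
  by (meson module_iso_sym module_iso_trans)

text \<open>A decomposition of the target pulls back along \<open>\<phi>\<close>: preimages of
  submodules are submodules, and bijectivity preserves intersections, sums and triviality.\<close>

lemma indecomposable_iso:
  fixes act :: "'r::ring_1 \<Rightarrow> 'v::ab_group_add \<Rightarrow> 'v" and act' :: "'r \<Rightarrow> 'w::ab_group_add \<Rightarrow> 'w"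
  assumes "act \<simeq>\<^sub>M act'" "indecomposable act"
  shows "indecomposable act'"
proof -
  obtain \<phi> where \<phi>: "bij \<phi>" "\<And>u v. \<phi> (u + v) = \<phi> u + \<phi> v" "\<And>r v. \<phi> (act r v) = act' r (\<phi> v)"
    using assms(1) by (auto simp: module_iso_def)
  have \<phi>0: "\<phi> 0 = 0" using \<phi>(2)[of 0 0] by simp
  have inj: "\<phi> x = \<phi> y \<longleftrightarrow> x = y" for x y by (metis \<phi>(1) bij_pointE)
  have surj: "\<exists>x. y = \<phi> x" for y by (metis \<phi>(1) bij_pointE)
  have sub: "submodule act (\<phi> -` U)" if "submodule act' U" for U
    using that by (auto simp: submodule_def \<phi> \<phi>0)
  have zero: "\<phi> -` U = {0} \<longleftrightarrow> U = {0}" for U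
    using surj inj \<phi>0 by (auto simp: set_eq_iff) (metis)+
  have "U = {0} \<or> W = {0}"
    if "submodule act' U" "submodule act' W" "U \<inter> W = {0}" and sum: "\<And>v. \<exists>u\<in>U. \<exists>w\<in>W. v = u + w" for U W
  proof -
    have "\<phi> -` U \<inter> \<phi> -` W = {0}" using zero[of "U \<inter> W"] that(3) by (metis vimage_Int)
    moreover have "\<exists>u\<in>\<phi> -` U. \<exists>w\<in>\<phi> -` W. v = u + w" for v
    proof -
      obtain u w where "u \<in> U" "w \<in> W" "\<phi> v = u + w" using sum by blast
      then show ?thesis using surj[of u] surj[of w] inj \<phi>(2) by force
    qed
    ultimately show ?thesis using assms(2) that(1,2) sub zero unfolding indecomposable_def by metis
  qed
  moreover have "(UNIV :: 'w set) \<noteq> {0}"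
    using assms(2) zero[of UNIV] by (auto simp: indecomposable_def)
  ultimately show ?thesis using assms(1) by (auto simp: indecomposable_def module_iso_def)
qed

section \<open>Passage between modules and pairs of matrices\<close>

lemma linear_matrix_exists:
  fixes f :: "'a::field^'n \<Rightarrow> 'a^'m"
  assumes "\<And>u v. f (u + v) = f u + f v" "\<And>c v. f (c *s v) = c *s f v"
  obtains A where "\<And>v. f v = A *v v"
proof -
  have "Vector_Spaces.linear (*s) (*s) f" by unfold_locales (simp_all add: assms vec.scale_right_distrib vec.scale_left_distrib)
  then show thesis using matrix_works that by metis
qed

lemma bij_matrix_iff_invertible:
  fixes P :: "'a::field^'n^'n"
  shows "bij ((*v) P) \<longleftrightarrow> invertible P"
  by (metis bij_def invertible_left_inverse invertible_right_inverse
      matrix_left_invertible_injective matrix_right_invertible_surjective)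

text \<open>An isomorphism commutes with the scalars of the algebra, hence is linear and has a
  matrix; conversely, intertwining the two generators suffices because they generate the algebra
  over the scalars.\<close>

lemma mat_module_iso_iff:
  fixes X1 X2 :: "'k::field^3^3"
  assumes X: "sjp_relations X1 X2" and Y: "sjp_relations Y1 Y2"
  shows "mat_module X1 X2 \<simeq>\<^sub>M mat_module Y1 Y2 \<longleftrightarrow>
    (\<exists>P. invertible P \<and> P ** X1 = Y1 ** P \<and> P ** X2 = Y2 ** P)"
proof
  assume "mat_module X1 X2 \<simeq>\<^sub>M mat_module Y1 Y2"
  then obtain \<phi> where \<phi>: "bij \<phi>" "\<And>u v. \<phi> (u + v) = \<phi> u + \<phi> v"
      "\<And>r v. \<phi> (mat_module X1 X2 r v) = mat_module Y1 Y2 r (\<phi> v)"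
    by (auto simp: module_iso_def)
  have "\<phi> (c *s v) = c *s \<phi> v" for c v
    using \<phi>(3)[of "sjp_scalar c" v] by (simp add: mat_module_scalar X Y)
  with \<phi>(2) obtain P where P: "\<And>v. \<phi> v = P *v v" by (rule linear_matrix_exists) blast
  have "invertible P" using \<phi>(1) P bij_matrix_iff_invertible[of P] by (metis ext)
  moreover have "P ** X1 = Y1 ** P" "P ** X2 = Y2 ** P"
    using \<phi>(3)[of "sjp_gen G1"] \<phi>(3)[of "sjp_gen G2"]
    by (simp_all add: mat_module_gen X Y P matrix_eq matrix_vector_mul_assoc)
  ultimately show "\<exists>P. invertible P \<and> P ** X1 = Y1 ** P \<and> P ** X2 = Y2 ** P" by blast
next
  assume "\<exists>P. invertible P \<and> P ** X1 = Y1 ** P \<and> P ** X2 = Y2 ** P"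
  then obtain P where P: "invertible P" "P ** X1 = Y1 ** P" "P ** X2 = Y2 ** P" by blast
  show "mat_module X1 X2 \<simeq>\<^sub>M mat_module Y1 Y2"
  proof (rule module_isoI[where \<phi> = "(*v) P"])
    fix g v
    show "P *v mat_module X1 X2 (sjp_gen g) v = mat_module Y1 Y2 (sjp_gen g) (P *v v)"
      by (cases g) (simp_all add: mat_module_gen X Y P matrix_vector_mul_assoc)
  qed (simp_all add: X Y P left_module_mat_module bij_matrix_iff_invertible
      matrix_vector_right_distrib mat_module_scalar vector_scalar_commute)
qed

text \<open>An invertible \<open>P\<close> can be cancelled on the right after being moved through
  the products of \<open>Y1\<close> and \<open>Y2\<close>. Evaluation at vectors turns this movement
  into plain rewriting.\<close>

lemma sjp_relations_conjugate:
  fixes X1 X2 :: "'k::field^3^3"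
  assumes "sjp_relations X1 X2" "invertible P" "P ** X1 = Y1 ** P" "P ** X2 = Y2 ** P"
  shows "sjp_relations Y1 Y2"
proof -
  obtain Q where Q: "P ** Q = mat 1" "Q ** P = mat 1" using assms(2) by (auto simp: invertible_def)
  have cancel: "A = B" if "A ** P = B ** P" for A B :: "'k^3^3"
    by (metis Q(1) matrix_mul_assoc matrix_mul_rid that)
  have mv: "P *v (X1 *v v) = Y1 *v (P *v v)" "P *v (X2 *v v) = Y2 *v (P *v v)" for v
    using assms(3,4) by (simp_all add: matrix_vector_mul_assoc)
  have r: "X1 *v (X1 *v v) = 0"
      "X2 *v (X2 *v (X1 *v v) + X1 *v (X2 *v v)) = X2 *v (X1 *v (X2 *v v)) + X1 *v (X2 *v (X2 *v v))
         + X1 *v (X2 *v (X1 *v v) + X1 *v (X2 *v v))" for v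
    using assms(1)
    by (simp_all add: sjp_relations_def Let_def matrix_eq matrix_vector_mult_add_rdistrib
      matrix_vector_mul_assoc[symmetric] matrix_vector_right_distrib)
  show ?thesis unfolding sjp_relations_def Let_def
  proof
    show "Y1 ** Y1 = 0"
      by (rule cancel) (simp add: matrix_eq matrix_vector_mul_assoc[symmetric] mv[symmetric] r)
    show "Y2 ** (Y2 ** Y1 + Y1 ** Y2) = (Y2 ** Y1 + Y1 ** Y2) ** Y2 + Y1 ** (Y2 ** Y1 + Y1 ** Y2)"
    proof (rule cancel, unfold matrix_eq, rule allI)
      fix v
      show "(Y2 ** (Y2 ** Y1 + Y1 ** Y2) ** P) *v v =
          (((Y2 ** Y1 + Y1 ** Y2) ** Y2 + Y1 ** (Y2 ** Y1 + Y1 ** Y2)) ** P) *v v"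
        using arg_cong[OF r(2)[of v], of "(*v) P"]
        by (simp add: matrix_vector_mul_assoc[symmetric] mv matrix_vector_mult_add_rdistrib
          matrix_vector_right_distrib)
    qed
  qed
qed

text \<open>Allows x1 to be put into normal form: x2 is carried along by the same change of
  basis.\<close>

lemma mat_module_conjugate:
  fixes X1 X2 :: "'k::field^3^3"
  assumes "sjp_relations X1 X2" "invertible P" "P ** X1 = Y1 ** P"
  obtains Y2 where "sjp_relations Y1 Y2" "mat_module X1 X2 \<simeq>\<^sub>M mat_module Y1 Y2" "P ** X2 = Y2 ** P"
proof -
  obtain Q where Q: "P ** Q = mat 1" "Q ** P = mat 1" using assms(2) by (auto simp: invertible_def)
  define Y2 where "Y2 = P ** X2 ** Q"
  have 1: "P ** X2 = Y2 ** P" by (simp add: Y2_def matrix_mul_assoc[symmetric] Q)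
  have 2: "sjp_relations Y1 Y2" using assms 1 by (rule sjp_relations_conjugate)
  have "mat_module X1 X2 \<simeq>\<^sub>M mat_module Y1 Y2"
    using assms 1 2 by (auto simp: mat_module_iso_iff)
  then show thesis using that 1 2 by blast
qed

text \<open>Coordinates in a basis of three vectors, indexed by the type \<open>3\<close>, transport
  the action to column vectors, where the generators become matrices.\<close>

lemma mat_module_iso_exists:
  fixes M :: "'k::field sjp \<Rightarrow> 'v::ab_group_add \<Rightarrow> 'v"
  assumes "left_module M" "sjp_dim M = 3"
  obtains X1 X2 where "sjp_relations X1 X2" "M \<simeq>\<^sub>M mat_module X1 X2"
proof -
  interpret left_module M by fact
  define scale where "scale c = M (sjp_scalar c)" for c
  interpret V: vector_space scale
    by unfold_locales
      (simp_all add: scale_def act_add_left act_add_right act_act act_one sjp_scalar_simps)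
  obtain B where B: "V.independent B" "V.span B = UNIV" "card B = 3"
    using V.basis_exists[of UNIV] assms(2)
    by (metis sjp_dim_def scale_def ext top.extremum_uniqueI)
  \<comment> \<open>An infinite set has cardinality 0 by convention, so cardinality 3 gives
    finiteness.\<close>
  then have fin: "finite B" by (metis card.infinite zero_neq_numeral)
  obtain h where h: "bij_betw h (UNIV :: 3 set) B"
    using finite_same_card_bij[of "UNIV :: 3 set" B] fin B(3) by auto
  define \<phi> where "\<phi> x = (\<Sum>i\<in>UNIV. scale (x $ i) (h i))" for x :: "'k^3"
  have \<phi>_add: "\<phi> (x + y) = \<phi> x + \<phi> y" for x y
    by (simp add: \<phi>_def V.scale_left_distrib sum.distrib)
  have \<phi>_scale: "\<phi> (c *s x) = scale c (\<phi> x)" for c x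
    by (simp add: \<phi>_def V.scale_sum_right)
  have \<phi>_sum: "\<phi> (\<chi> i. u (h i)) = (\<Sum>b\<in>B. scale (u b) b)" for u
    using sum.reindex_bij_betw[OF h, of "\<lambda>b. scale (u b) b"] by (simp add: \<phi>_def)
  have "surj \<phi>"
  proof -
    have "\<exists>x. v = \<phi> x" for v
      
    proof -
      have "v \<in> range (\<lambda>u. \<Sum>b\<in>B. scale (u b) b)"
        using B(2) V.span_finite[OF fin] by simp
      then show ?thesis by (auto simp flip: \<phi>_sum)
    qed
    then show ?thesis by blast
  qed
  moreover have "inj \<phi>"
  proof (rule injI)
    fix x y assume "\<phi> x = \<phi> y"
    then have zero: "\<phi> (x - y) = 0" using \<phi>_add[of "x - y" y] by simp
    \<comment> \<open>Reindexing along \<open>h\<close> turns the coordinates into a coefficient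
      function on \<open>B\<close>, the form in which linear independence is expressed.\<close>
    have "x - y = (\<chi> i. (x - y) $ inv_into UNIV h (h i))"
      using h by (simp add: vec_eq_iff bij_betw_def)
    then obtain u where u: "x - y = (\<chi> i. u (h i))" by fast
    have "(\<Sum>b\<in>B. scale (u b) b) = 0" using zero unfolding u \<phi>_sum .
    then have "\<And>b. b \<in> B \<Longrightarrow> u b = 0" using B(1) V.dependent_finite[OF fin] by auto
    then have "x - y = 0" unfolding u using h by (auto simp: vec_eq_iff bij_betw_def)
    then show "x = y" by simp
  qed
  ultimately have \<phi>: "bij \<phi>" by (simp add: bij_def)
  define \<psi> where "\<psi> = inv \<phi>"
  have \<phi>\<psi> [simp]: "\<phi> (\<psi> v) = v" for v using \<open>surj \<phi>\<close> by (simp add: \<psi>_def surj_f_inv_f)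
  have \<psi>\<phi> [simp]: "\<psi> (\<phi> x) = x" for x using \<open>inj \<phi>\<close> by (simp add: \<psi>_def)
  have \<psi>_add: "\<psi> (u + v) = \<psi> u + \<psi> v" for u v by (metis \<phi>\<psi> \<psi>\<phi> \<phi>_add)
  have \<psi>_scale: "\<psi> (scale c v) = c *s \<psi> v" for c v by (metis \<phi>\<psi> \<psi>\<phi> \<phi>_scale)
  have \<psi>_0: "\<psi> 0 = 0" using \<psi>_add[of 0 0] by simp
  have M_0: "M 0 v = 0" for v using act_add_left[of 0 0 v] by simp
  have "\<exists>X. \<forall>v. \<psi> (M (sjp_gen g) (\<phi> v)) = X *v v" for g
  proof -
    have "M (sjp_gen g) (scale c v) = scale c (M (sjp_gen g) v)" for c v
      by (simp add: scale_def act_act sjp_scalar_central)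
    then show ?thesis
      by (rule_tac linear_matrix_exists[of "\<lambda>v. \<psi> (M (sjp_gen g) (\<phi> v))"])
        (auto simp: \<phi>_add \<phi>_scale \<psi>_add \<psi>_scale act_add_right)
  qed
  then obtain X where X: "\<And>g v. X g *v v = \<psi> (M (sjp_gen g) (\<phi> v))" by metis
  have rel: "sjp_relations (X G1) (X G2)"
  proof -
    have "X G1 *v (X G1 *v v) = 0" for v
      by (simp add: X act_act sjp_gen_relations(1) M_0 \<psi>_0)
    moreover have "X G2 *v (X G2 *v (X G1 *v v) + X G1 *v (X G2 *v v)) =
        X G2 *v (X G1 *v (X G2 *v v)) + X G1 *v (X G2 *v (X G2 *v v))
        + X G1 *v (X G2 *v (X G1 *v v) + X G1 *v (X G2 *v v))" for v
      unfolding X \<phi>_add \<phi>\<psi> act_act \<psi>_add[symmetric] act_add_left[symmetric]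
        sjp_gen_relations(2) distrib_right mult.assoc ..
    ultimately show ?thesis
      by (simp add: sjp_relations_def Let_def matrix_eq matrix_vector_mult_add_rdistrib
        matrix_vector_mul_assoc[symmetric])
  qed
  moreover have "M \<simeq>\<^sub>M mat_module (X G1) (X G2)"
  proof (rule module_isoI[where \<phi> = \<psi>])
    show "bij \<psi>" by (simp add: \<psi>_def \<phi> bij_imp_bij_inv)
    fix g v
    show "\<psi> (M (sjp_gen g) v) = mat_module (X G1) (X G2) (sjp_gen g) (\<psi> v)"
      by (cases g) (simp_all add: mat_module_gen[OF rel] X)
  qed (use assms \<psi>_add \<psi>_scale[unfolded scale_def] rel in
      \<open>auto simp: left_module_mat_module mat_module_scalar\<close>)
  ultimately show thesis by (rule that)
qed


section \<open>Three by three matrices and indecomposability\<close>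

lemma mat3_nth [simp]:
  "mat3 a11 a12 a13 a21 a22 a23 a31 a32 a33 $ 1 $ 1 = a11"
  "mat3 a11 a12 a13 a21 a22 a23 a31 a32 a33 $ 1 $ 2 = a12"
  "mat3 a11 a12 a13 a21 a22 a23 a31 a32 a33 $ 1 $ 3 = a13"
  "mat3 a11 a12 a13 a21 a22 a23 a31 a32 a33 $ 2 $ 1 = a21"
  "mat3 a11 a12 a13 a21 a22 a23 a31 a32 a33 $ 2 $ 2 = a22"
  "mat3 a11 a12 a13 a21 a22 a23 a31 a32 a33 $ 2 $ 3 = a23"
  "mat3 a11 a12 a13 a21 a22 a23 a31 a32 a33 $ 3 $ 1 = a31"
  "mat3 a11 a12 a13 a21 a22 a23 a31 a32 a33 $ 3 $ 2 = a32"
  "mat3 a11 a12 a13 a21 a22 a23 a31 a32 a33 $ 3 $ 3 = a33"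
  by (simp_all add: mat3_def)

lemma mat3_exhaust:
  obtains a11 a12 a13 a21 a22 a23 a31 a32 a33 where
    "A = mat3 a11 a12 a13 a21 a22 a23 a31 a32 a33"
proof -
  have "A = mat3 (A$1$1) (A$1$2) (A$1$3) (A$2$1) (A$2$2) (A$2$3) (A$3$1) (A$3$2) (A$3$3)"
    by (simp add: vec_eq_iff forall_3)
  then show thesis by (rule that)
qed

lemma mat3_eq_iff:
  "mat3 a11 a12 a13 a21 a22 a23 a31 a32 a33 = mat3 b11 b12 b13 b21 b22 b23 b31 b32 b33 \<longleftrightarrow>
    a11 = b11 \<and> a12 = b12 \<and> a13 = b13 \<and> a21 = b21 \<and> a22 = b22 \<and> a23 = b23 \<and>
    a31 = b31 \<and> a32 = b32 \<and> a33 = b33"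
  by (auto simp: vec_eq_iff forall_3)

lemma mat3_mult:
  "mat3 a11 a12 a13 a21 a22 a23 a31 a32 a33 ** mat3 b11 b12 b13 b21 b22 b23 b31 b32 b33 =
    mat3 (a11*b11 + a12*b21 + a13*b31) (a11*b12 + a12*b22 + a13*b32) (a11*b13 + a12*b23 + a13*b33)
      (a21*b11 + a22*b21 + a23*b31) (a21*b12 + a22*b22 + a23*b32) (a21*b13 + a22*b23 + a23*b33)
      (a31*b11 + a32*b21 + a33*b31) (a31*b12 + a32*b22 + a33*b32) (a31*b13 + a32*b23 + a33*b33)"
  by (simp add: vec_eq_iff forall_3 matrix_matrix_mult_def sum_3)

lemma mat3_add:
  "mat3 a11 a12 a13 a21 a22 a23 a31 a32 a33 + mat3 b11 b12 b13 b21 b22 b23 b31 b32 b33 =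
    mat3 (a11+b11) (a12+b12) (a13+b13) (a21+b21) (a22+b22) (a23+b23) (a31+b31) (a32+b32) (a33+b33)"
  by (simp add: vec_eq_iff forall_3)

lemma mat3_diff:
  "mat3 a11 a12 a13 a21 a22 a23 a31 a32 a33 - mat3 b11 b12 b13 b21 b22 b23 b31 b32 b33 =
    mat3 (a11-b11) (a12-b12) (a13-b13) (a21-b21) (a22-b22) (a23-b23) (a31-b31) (a32-b32) (a33-b33)"
  by (simp add: vec_eq_iff forall_3)

lemma mat_eq_mat3: "mat c = mat3 c 0 0 0 c 0 0 0 c"
  by (simp add: vec_eq_iff forall_3 mat_def)

lemma zero_eq_mat3: "0 = mat3 0 0 0 0 0 0 0 0 0"
  by (simp add: vec_eq_iff forall_3)

lemma invertible_mat3: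
  "invertible (mat3 a11 a12 a13 a21 a22 a23 a31 a32 a33 :: 'k::field^3^3) \<longleftrightarrow>
    a11*a22*a33 + a12*a23*a31 + a13*a21*a32 - a11*a23*a32 - a12*a21*a33 - a13*a22*a31 \<noteq> 0"
  by (simp add: invertible_det_nz det_3)

lemmas mat3_simps = mat3_mult mat3_add mat3_diff mat_eq_mat3 zero_eq_mat3 mat3_eq_iff

text \<open>Commuting with \<open>E12\<close> clears the first column and the second row off the
  diagonal and equates the first two diagonal entries. The determinant is then
  \<open>x * x * v\<close>, which explains the two nonvanishing conditions.\<close>

lemma ex_commutes_E12_iff:
  fixes Q :: "'k::field^3^3 \<Rightarrow> bool"
  shows "(\<exists>P. invertible P \<and> P ** E12 = E12 ** P \<and> Q P) \<longleftrightarrow>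
    (\<exists>x y z u v. x \<noteq> 0 \<and> v \<noteq> 0 \<and> Q (mat3 x y z 0 x 0 0 u v))"
    (is "?L \<longleftrightarrow> ?R")
proof
  assume ?L
  then obtain P where P: "invertible P" "P ** E12 = E12 ** P" "Q P" by blast
  obtain a11 a12 a13 a21 a22 a23 a31 a32 a33
    where "P = mat3 a11 a12 a13 a21 a22 a23 a31 a32 a33" by (rule mat3_exhaust)
  with P have m: "P = mat3 a11 a12 a13 0 a11 0 0 a32 a33"
    by (simp add: E12_def mat3_simps)
  then have "a11 \<noteq> 0" "a33 \<noteq> 0" using P(1) by (auto simp: invertible_mat3)
  then show ?R using P(3) m by blast
next
  assume ?R
  then obtain x y z u v where "x \<noteq> 0" "v \<noteq> 0" "Q (mat3 x y z 0 x 0 0 u v)" by blast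
  then show ?L
    by (intro exI[of _ "mat3 x y z 0 x 0 0 u v"]) (simp add: E12_def mat3_simps invertible_mat3)
qed

lemma E12_module_iso_iff:
  fixes X Y :: "'k::field^3^3"
  assumes "sjp_relations E12 X" "sjp_relations E12 Y"
  shows "mat_module E12 X \<simeq>\<^sub>M mat_module E12 Y \<longleftrightarrow>
    (\<exists>x y z u v. x \<noteq> 0 \<and> v \<noteq> 0 \<and> mat3 x y z 0 x 0 0 u v ** X = Y ** mat3 x y z 0 x 0 0 u v)"
  unfolding mat_module_iso_iff[OF assms] by (rule ex_commutes_E12_iff)

text \<open>A commuting idempotent splits the module into its fixed space and its kernel;
  conversely, a decomposition yields the projection onto one summand along the other.\<close>

lemma indecomposable_mat_module_iff:
  fixes X1 X2 :: "'k::field^3^3"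
  assumes "sjp_relations X1 X2"
  shows "indecomposable (mat_module X1 X2) \<longleftrightarrow>
    (\<forall>E. E ** E = E \<and> E ** X1 = X1 ** E \<and> E ** X2 = X2 ** E \<longrightarrow> E = 0 \<or> E = mat 1)"
    (is "indecomposable ?M \<longleftrightarrow> ?R")
proof
  interpret left_module ?M using assms by (rule left_module_mat_module)
  note gens = mat_module_gen[OF assms] mat_module_scalar[OF assms]
  {
    assume ind: "indecomposable ?M"
    show ?R
    proof (intro allI impI, elim conjE)
      fix E :: "'k^3^3"
      assume E: "E ** E = E" "E ** X1 = X1 ** E" "E ** X2 = X2 ** E"
      have comm: "E *v ?M r v = ?M r (E *v v)" for r v
      proof (induction r arbitrary: v rule: sjp_induct)
        case (gen g)
        then show ?case by (cases g) (simp_all add: gens matrix_vector_mul_assoc E)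
      qed (simp_all add: gens vector_scalar_commute act_add_left matrix_vector_right_distrib
          flip: act_act)
      have EE: "E *v (E *v v) = E *v v" for v by (simp add: matrix_vector_mul_assoc E)
      define U where "U = {v. E *v v = v}"
      define W where "W = {v. E *v v = 0}"
      have M0: "?M r 0 = 0" for r using act_add_right[of r 0 0] by simp
      have "submodule ?M U" "submodule ?M W"
        by (auto simp: submodule_def U_def W_def matrix_vector_right_distrib comm M0)
      moreover have "U \<inter> W = {0}" by (auto simp: U_def W_def)
      moreover have "\<exists>u\<in>U. \<exists>w\<in>W. v = u + w" for v
        by (rule bexI[of _ "E *v v"], rule bexI[of _ "v - E *v v"])
          (auto simp: U_def W_def EE matrix_vector_mult_diff_distrib)
      ultimately have "U = {0} \<or> W = {0}" using ind by (simp add: indecomposable_def)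
      then show "E = 0 \<or> E = mat 1"
      proof
        assume "U = {0}"
        moreover have "E *v v \<in> U" for v by (simp add: U_def EE)
        ultimately have "E *v v = 0" for v by blast
        then show ?thesis by (simp add: matrix_eq)
      next
        assume "W = {0}"
        moreover have "v - E *v v \<in> W" for v
          by (simp add: W_def EE matrix_vector_mult_diff_distrib)
        ultimately have "v - E *v v = 0" for v by blast
        then show ?thesis by (simp add: matrix_eq)
      qed
    qed
  }
  assume ?R
  have "U = {0} \<or> W = {0}"
    if U: "submodule ?M U" and W: "submodule ?M W" and UW: "U \<inter> W = {0}"
      and sum: "\<And>v. \<exists>u\<in>U. \<exists>w\<in>W. v = u + w" for U W
  proof -
    have scale: "c *s v \<in> S" "X1 *v v \<in> S" "X2 *v v \<in> S" if "submodule ?M S" "v \<in> S" for c v S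
      using that gens unfolding submodule_def by metis+
    have U_diff: "u - u' \<in> U" if "u \<in> U" "u' \<in> U" for u u'
    proof -
      have "u + (- 1) *s u' \<in> U" using U that scale(1) unfolding submodule_def by blast
      then show ?thesis by simp
    qed
    have W_diff: "w - w' \<in> W" if "w \<in> W" "w' \<in> W" for w w'
    proof -
      have "w + (- 1) *s w' \<in> W" using W that scale(1) unfolding submodule_def by blast
      then show ?thesis by simp
    qed
    \<comment> \<open>\<open>p\<close> is the projection onto \<open>U\<close> along
      \<open>W\<close>. Its uniqueness \<open>p_eq\<close> gives additivity, homogeneity and
      commutation with the generators: each time the expected value lies in \<open>U\<close> and
      differs from the argument by an element of \<open>W\<close>.\<close>
    have "\<exists>p. p \<in> U \<and> v - p \<in> W" for v using sum[of v] by force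
    then obtain p where p: "\<And>v. p v \<in> U" "\<And>v. v - p v \<in> W" by metis
    have p_eq: "p v = u" if "u \<in> U" "v - u \<in> W" for u v
    proof -
      have "p v - u = (v - u) - (v - p v)" by simp
      then have "p v - u \<in> U \<inter> W" using U_diff[OF p(1) that(1)] W_diff[OF that(2) p(2)] by (metis IntI)
      then show ?thesis using UW by simp
    qed
    have p_add: "p (v + w) = p v + p w" for v w
    proof (rule p_eq)
      show "p v + p w \<in> U" using U p(1) by (simp add: submodule_def)
      have "(v - p v) + (w - p w) \<in> W" using W p(2) by (simp add: submodule_def)
      then show "v + w - (p v + p w) \<in> W" by (simp add: algebra_simps)
    qed
    have p_scale: "p (c *s v) = c *s p v" for c v
      using scale(1)[OF W p(2)[of v], of c]
      by (intro p_eq) (simp_all add: scale(1)[OF U p(1)] vec.scale_right_diff_distrib)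
    have p_X: "p (X1 *v v) = X1 *v p v" "p (X2 *v v) = X2 *v p v" for v
      using scale(2,3)[OF W p(2)[of v]]
      by (auto intro!: p_eq simp: scale(2,3)[OF U p(1)] matrix_vector_mult_diff_distrib)
    have p_U: "p u = u" if "u \<in> U" for u
      using W that by (intro p_eq) (auto simp: submodule_def)
    obtain E where E: "\<And>v. p v = E *v v" using linear_matrix_exists[of p] p_add p_scale by blast
    have "E ** E = E" "E ** X1 = X1 ** E" "E ** X2 = X2 ** E"
      using p_X p_U[OF p(1)] by (simp_all add: E matrix_eq matrix_vector_mul_assoc)
    then consider "E = 0" | "E = mat 1" using \<open>?R\<close> by blast
    then show ?thesis
    proof cases
      case 1
      then have "u = 0" if "u \<in> U" for u using p_U[OF that] by (simp add: E)
      then show ?thesis using U by (auto simp: submodule_def)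
    next
      case 2
      have "w = 0" if "w \<in> W" for w
        using p_eq[of 0 w] U that by (simp add: E 2 submodule_def)
      then show ?thesis using W by (auto simp: submodule_def)
    qed
  qed
  moreover have "axis 1 1 \<noteq> (0 :: 'k^3)" by (simp add: axis_eq_0_iff)
  then have "(UNIV :: ('k^3) set) \<noteq> {0}" by blast
  ultimately show "indecomposable ?M"
    using left_module_mat_module[OF assms] by (simp add: indecomposable_def)
qed

lemma idempotent_field: "x * x = x \<longleftrightarrow> x = 0 \<or> x = 1" for x :: "'k::field"
  by (metis mult_cancel_right1 mult_zero_left)

text \<open>The diagonal value x is 0 or 1. An off-diagonal entry w with
  \<open>x * w + w * x = w\<close> then satisfies 0 = w or w + w = w, so it vanishes in either case;
  y follows once the product \<open>z * u\<close> is gone.\<close>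

lemma idempotent_mat3:
  fixes x y z u :: "'k::field"
  assumes "mat3 x y z 0 x 0 0 u x ** mat3 x y z 0 x 0 0 u x = mat3 x y z 0 x 0 0 u x"
  shows "mat3 x y z 0 x 0 0 u x = 0 \<or> mat3 x y z 0 x 0 0 u x = mat 1"
proof -
  have eqs: "x * x = x" "x * y + y * x + z * u = y" "x * z + z * x = z" "u * x + x * u = u"
    using assms unfolding mat3_mult mat3_eq_iff by simp_all
  have off: "w = 0" if "x * w + w * x = w" for w
    proof (cases "x = 0")
    case False
    then have "w + w = w" using that eqs(1) by (simp add: idempotent_field)
    then show ?thesis by (metis add_cancel_left_left)
  qed (use that in simp)
  have "z = 0" "u = 0" using off eqs(3,4) by (metis add.commute)+
  then have "y = 0" using off eqs(2) by simp
  with \<open>z = 0\<close> \<open>u = 0\<close> eqs(1)[unfolded idempotent_field] show ?thesis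
    by (auto simp: mat_eq_mat3 zero_eq_mat3)
qed

text \<open>An endomorphism is given by a matrix \<open>E\<close> with diagonal \<open>(x, x, v)\<close>; an idempotent one is
  \<open>0\<close> or \<open>1\<close> as soon as the diagonal is constant.\<close>

lemma indecomposable_E12_iff:
  fixes X :: "'k::field^3^3"
  assumes "sjp_relations E12 X"
  shows "indecomposable (mat_module E12 X) \<longleftrightarrow>
    (\<forall>x y z u v. (let E = mat3 x y z 0 x 0 0 u v in E ** E = E \<and> E ** X = X ** E) \<longrightarrow> v = x)"
    (is "_ \<longleftrightarrow> ?R")
  unfolding indecomposable_mat_module_iff[OF assms]
proof
  assume L: "\<forall>E. E ** E = E \<and> E ** E12 = E12 ** E \<and> E ** X = X ** E \<longrightarrow> E = 0 \<or> E = mat 1"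
  show ?R unfolding Let_def
  proof (intro allI impI)
    fix x y z u v :: 'k
    let ?E = "mat3 x y z 0 x 0 0 u v"
    assume E: "?E ** ?E = ?E \<and> ?E ** X = X ** ?E"
    have "?E ** E12 = E12 ** ?E" by (simp add: E12_def mat3_mult)
    then have "?E = 0 \<or> ?E = mat 1" using L E by blast
    then show "v = x" by (auto simp: mat3_simps)
  qed
next
  assume R: ?R
  show "\<forall>E. E ** E = E \<and> E ** E12 = E12 ** E \<and> E ** X = X ** E \<longrightarrow> E = 0 \<or> E = mat 1"
  proof (intro allI impI, elim conjE)
    fix E :: "'k^3^3"
    assume E: "E ** E = E" "E ** E12 = E12 ** E" "E ** X = X ** E"
    obtain a11 a12 a13 a21 a22 a23 a31 a32 a33
      where m: "E = mat3 a11 a12 a13 a21 a22 a23 a31 a32 a33" by (rule mat3_exhaust)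
    have "a21 = 0" "a31 = 0" "a23 = 0" "a22 = a11" using E(2) by (simp_all add: m E12_def mat3_simps)
    then have m': "E = mat3 a11 a12 a13 0 a11 0 0 a32 a33" by (simp add: m)
    have "a33 = a11" using R E(1,3) unfolding m' Let_def by blast
    then show "E = 0 \<or> E = mat 1" using idempotent_mat3 E(1) unfolding m' by blast
  qed
qed


section \<open>The families\<close>

text \<open>The quotients are named \<open>f\<close>, \<open>f'\<close> and \<open>q\<close> and
  characterised by polynomial equations, so that eliminating y, z, u and v becomes a problem in a
  commutative ring.\<close>

lemma Y_module_iso_iff:
  fixes a b c d e b' c' d' e' :: "'k::field"
  assumes e: "e \<noteq> 0" "e' \<noteq> 0"
  shows "Y_module a b c d e \<simeq>\<^sub>M Y_module a b' c' d' e' \<longleftrightarrow>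
    (a - d') * ((c * e' - c' * e) / e') = e * (b' - b) + c * (d - d')" (is "?L \<longleftrightarrow> ?R")
proof -
  define f where "f = (a^2 - d^2) / e"
  define f' where "f' = (a^2 - d'^2) / e'"
  define q where "q = (c * e' - c' * e) / e'"
  have f: "f * e = a^2 - d^2" "f' * e' = a^2 - d'^2" and q: "q * e' = c * e' - c' * e"
    using e by (simp_all add: f_def f'_def q_def)
  have L: "?L \<longleftrightarrow> (\<exists>x y z u v. x \<noteq> 0 \<and> v \<noteq> 0 \<and>
      mat3 x y z 0 x 0 0 u v ** mat3 a b c 0 d e 0 f (- d) =
      mat3 a b' c' 0 d' e' 0 f' (- d') ** mat3 x y z 0 x 0 0 u v)"
    unfolding Y_module_def f_def f'_def using e
    by (intro E12_module_iso_iff sjp_relations_families)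
  show ?thesis unfolding q_def[symmetric]
  proof
    assume ?L
    then obtain x y z u v where x: "x \<noteq> 0" and
      "mat3 x y z 0 x 0 0 u v ** mat3 a b c 0 d e 0 f (- d) =
       mat3 a b' c' 0 d' e' 0 f' (- d') ** mat3 x y z 0 x 0 0 u v"
      unfolding L by blast
    then have "x * e = e' * v" "x * d = d' * x + e' * u"
      "x * b + y * d + z * f = a * y + b' * x + c' * u" "x * c + y * e - z * d = a * z + c' * v"
      by (simp_all add: mat3_simps)
    with f q have "x * e' * ((a - d') * q) = x * e' * (e * (b' - b) + c * (d - d'))" by algebra
    then show "(a - d') * q = e * (b' - b) + c * (d - d')" using x e by simp
  next
    assume R: "(a - d') * q = e * (b' - b) + c * (d - d')"
    \<comment> \<open>With x = 1 and z = 0, entries (2,3), (2,2) and (1,3) of the intertwining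
      equation determine v, u and y. Entry (1,2) is then the assumed condition, and row 3 holds
      identically.\<close>
    define v where "v = e / e'"
    define u where "u = (d - d') / e'"
    define y where "y = (c' * v - c) / e"
    have w: "v * e' = e" "u * e' = d - d'" "y * e = c' * v - c"
      using e by (simp_all add: v_def u_def y_def)
    have "e * e' * (b + y * d) = e * e' * (a * y + b' + c' * u)" using R q w by algebra
    then have 1: "b + y * d = a * y + b' + c' * u" using e by simp
    have 2: "u * d + v * f = f' - d' * u"
      using e by (simp add: u_def v_def f_def f'_def field_simps power2_eq_square)
    have 3: "u * e - v * d = - d' * v" using e by (simp add: u_def v_def field_simps)
    have "v \<noteq> 0" using e by (simp add: v_def)
    then have "\<exists>x y z u v. x \<noteq> 0 \<and> v \<noteq> 0 \<and>
      mat3 x y z 0 x 0 0 u v ** mat3 a b c 0 d e 0 f (- d) =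
      mat3 a b' c' 0 d' e' 0 f' (- d') ** mat3 x y z 0 x 0 0 u v"
      using 1 2 3 w
      by (intro exI[of _ 1] exI[of _ y] exI[of _ 0] exI[of _ u] exI[of _ v])
        (simp add: mat3_simps algebra_simps)
    then show ?L unfolding L .
  qed
qed

lemma W_module_iso_iff:
  fixes a b c d e a' b' d' e' :: "'k::field"
  assumes d: "d \<noteq> 0" "d' \<noteq> 0"
  shows "W_module a b c d e \<simeq>\<^sub>M W_module a' b' c d' e' \<longleftrightarrow>
    (a * e - b * d - c * e) / d = (a' * e' - b' * d' - c * e') / d'" (is "?L \<longleftrightarrow> ?R")
proof -
  define g where "g = (c^2 - a^2) / d"
  define g' where "g' = (c^2 - a'^2) / d'"
  have g: "g * d = c^2 - a^2" "g' * d' = c^2 - a'^2" using d by (simp_all add: g_def g'_def)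
  have R: "?R \<longleftrightarrow> d' * (a * e - b * d - c * e) = d * (a' * e' - b' * d' - c * e')"
    using d by (simp add: frac_eq_eq mult.commute)
  have L: "?L \<longleftrightarrow> (\<exists>x y z u v. x \<noteq> 0 \<and> v \<noteq> 0 \<and>
      mat3 x y z 0 x 0 0 u v ** mat3 a b g 0 c 0 d e (- a) =
      mat3 a' b' g' 0 c 0 d' e' (- a') ** mat3 x y z 0 x 0 0 u v)"
    unfolding W_module_def g_def g'_def using d
    by (intro E12_module_iso_iff sjp_relations_families)
  show ?thesis
  proof
    assume ?L
    then obtain x y z u v where x: "x \<noteq> 0" and
      "mat3 x y z 0 x 0 0 u v ** mat3 a b g 0 c 0 d e (- a) =
       mat3 a' b' g' 0 c 0 d' e' (- a') ** mat3 x y z 0 x 0 0 u v"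
      unfolding L by blast
    then have "x * a + z * d = a' * x" "x * b + y * c + z * e = a' * y + b' * x + g' * u"
      "v * d = d' * x" "u * c + v * e = d' * y + e' * x - a' * u"
      by (simp_all add: mat3_simps)
    with g have "x * (d' * (a * e - b * d - c * e)) = x * (d * (a' * e' - b' * d' - c * e'))"
      by algebra
    then show ?R unfolding R using x by simp
  next
    assume ?R
    \<comment> \<open>With x = 1 and u = 0, entries (3,1), (1,1) and (3,2) determine v, z and y.
      Entry (1,2) is the assumed condition.\<close>
    define v where "v = d' / d"
    define z where "z = (a' - a) / d"
    define y where "y = (v * e - e') / d'"
    have w: "v * d = d'" "z * d = a' - a" "y * d' = v * e - e'"
      using d by (simp_all add: v_def z_def y_def)
    have "d * d' * (b + y * c + z * e) = d * d' * (a' * y + b')" using \<open>?R\<close> w unfolding R by algebra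
    then have 1: "b + y * c + z * e = a' * y + b'" using d by simp
    have 2: "g - z * a = a' * z + g' * v"
      using d by (simp add: z_def v_def g_def g'_def field_simps power2_eq_square)
    have 3: "v * a = a' * v - d' * z" using d by (simp add: z_def v_def field_simps)
    have "v \<noteq> 0" using d by (simp add: v_def)
    then have "\<exists>x y z u v. x \<noteq> 0 \<and> v \<noteq> 0 \<and>
      mat3 x y z 0 x 0 0 u v ** mat3 a b g 0 c 0 d e (- a) =
      mat3 a' b' g' 0 c 0 d' e' (- a') ** mat3 x y z 0 x 0 0 u v"
      using 1 2 3 w
      by (intro exI[of _ 1] exI[of _ y] exI[of _ z] exI[of _ 0] exI[of _ v])
        (simp add: mat3_simps algebra_simps)
    then show ?L unfolding L .
  qed
qed

text \<open>Entries (1,3) and (3,2) say that b and c are rescaled by inverse factors,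
  \<open>v / x\<close> being the quotient of b by b'. The orbits of nonzero pairs under this action
  are told apart by the product and by which coordinate vanishes.\<close>

lemma T_module_iso_iff:
  fixes a b c b' c' :: "'k::field"
  assumes "b \<noteq> 0 \<or> c \<noteq> 0" "b' \<noteq> 0 \<or> c' \<noteq> 0"
  shows "T_module a b c \<simeq>\<^sub>M T_module a b' c' \<longleftrightarrow>
    b * c = b' * c' \<and> (b = 0 \<longleftrightarrow> b' = 0) \<and> (c = 0 \<longleftrightarrow> c' = 0)" (is "?L \<longleftrightarrow> ?R")
proof -
  have L: "?L \<longleftrightarrow> (\<exists>x y z u v. x \<noteq> 0 \<and> v \<noteq> 0 \<and>
      mat3 x y z 0 x 0 0 u v ** mat3 a 0 b 0 a 0 0 c a =
      mat3 a 0 b' 0 a 0 0 c' a ** mat3 x y z 0 x 0 0 u v)"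
    unfolding T_module_def by (intro E12_module_iso_iff sjp_relations_families)
  show ?thesis
  proof
    assume ?L
    then obtain x y z u v where x: "x \<noteq> 0" "v \<noteq> 0" and
      "mat3 x y z 0 x 0 0 u v ** mat3 a 0 b 0 a 0 0 c a =
       mat3 a 0 b' 0 a 0 0 c' a ** mat3 x y z 0 x 0 0 u v"
      unfolding L by blast
    then have w: "x * b = b' * v" "v * c = c' * x" by (simp_all add: mat3_simps mult.commute)
    then have "x * v * (b * c) = x * v * (b' * c')" by algebra
    then have "b * c = b' * c'" using x by simp
    moreover have "b = 0 \<longleftrightarrow> b' = 0" "c = 0 \<longleftrightarrow> c' = 0"
      using w x by (metis mult_eq_0_iff)+
    ultimately show ?R by blast
  next
    assume R: ?R
    \<comment> \<open>For \<open>b = 0\<close> the entry c is nonzero and alone fixes the ratio;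
      otherwise b fixes it, and equality of the products takes care of c.\<close>
    define v where "v = (if b = 0 then c' / c else b / b')"
    have v: "v \<noteq> 0" "b = b' * v" "v * c = c'"
      using R assms by (auto simp: v_def field_simps)
    then have "\<exists>x y z u v. x \<noteq> 0 \<and> v \<noteq> 0 \<and>
      mat3 x y z 0 x 0 0 u v ** mat3 a 0 b 0 a 0 0 c a =
      mat3 a 0 b' 0 a 0 0 c' a ** mat3 x y z 0 x 0 0 u v"
      by (intro exI[of _ 1] exI[of _ 0] exI[of _ 0] exI[of _ 0] exI[of _ v])
        (simp add: mat3_simps algebra_simps)
    then show ?L unfolding L .
  qed
qed

text \<open>Entry (2,3) of the commutation reads \<open>x * e = e * v\<close>, which makes the
  diagonal of the idempotent constant.\<close>

lemma indecomposable_Y_module: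
  fixes a b c d e :: "'k::field"
  assumes "e \<noteq> 0"
  shows "indecomposable (Y_module a b c d e)"
  unfolding Y_module_def indecomposable_E12_iff[OF sjp_relations_families(2)[OF assms]]
  using assms by (simp add: Let_def mat3_mult mat3_eq_iff mult.commute)

text \<open>Here entry (3,1) decides: \<open>v * d = d * x\<close>.\<close>

lemma indecomposable_W_module:
  fixes a b c d e :: "'k::field"
  assumes "d \<noteq> 0"
  shows "indecomposable (W_module a b c d e)"
  unfolding W_module_def indecomposable_E12_iff[OF sjp_relations_families(4)[OF assms]]
  using assms by (simp add: Let_def mat3_mult mat3_eq_iff mult.commute)

text \<open>Common to \<open>\<Theta>\<^sub>2\<close> (where \<open>s = a\<close>) and \<open>\<Theta>\<^sub>4\<close> (where \<open>s = - a\<close>). A complement of the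
  two-dimensional summand exists when the off-diagonal entries \<open>c\<close>, \<open>d\<close> can be cleared.\<close>

lemma indecomposable_E12_triangular_iff:
  fixes a b c d e s :: "'k::field"
  assumes rel: "sjp_relations E12 (mat3 a b c 0 s 0 0 d e)"
  shows "indecomposable (mat_module E12 (mat3 a b c 0 s 0 0 d e)) \<longleftrightarrow>
    (c \<noteq> 0 \<and> e = a) \<or> (d \<noteq> 0 \<and> e = s)" (is "?L \<longleftrightarrow> ?R")
proof
  show ?R if ?L
  proof (rule ccontr)
    assume "\<not> ?R"
    then have cd: "c = 0 \<or> e \<noteq> a" "d = 0 \<or> e \<noteq> s" by auto
    \<comment> \<open>The idempotent below is the column (z, 0, 1) times the row (0, u, 1), a right
      and a left eigenvector for e. If \<open>e = a\<close>, then \<open>c = 0\<close> and division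
      by zero gives the admissible value \<open>z = 0\<close>; likewise for u.\<close>
    define z where "z = c / (e - a)"
    define u where "u = d / (e - s)"
    have z: "z * (e - a) = c" and u: "u * (e - s) = d" using cd by (auto simp: z_def u_def)
    have "z * d + z * u * s = c * u + a * z * u"
      by (simp add: algebra_simps flip: z u)
    then have "let E = mat3 0 (z * u) z 0 0 0 0 u 1 in
        E ** E = E \<and> E ** mat3 a b c 0 s 0 0 d e = mat3 a b c 0 s 0 0 d e ** E"
      by (simp add: Let_def mat3_simps algebra_simps flip: z u)
    with that have "(1 :: 'k) = 0" unfolding indecomposable_E12_iff[OF rel] by blast
    then show False by simp
  qed
  assume ?R
  show ?L unfolding indecomposable_E12_iff[OF rel] Let_def
  proof (intro allI impI)
    fix x y z u v :: 'k
    let ?E = "mat3 x y z 0 x 0 0 u v"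
    assume "?E ** ?E = ?E \<and> ?E ** mat3 a b c 0 s 0 0 d e = mat3 a b c 0 s 0 0 d e ** ?E"
    then have "x * c + z * e = a * z + c * v" "u * s + v * d = d * x + e * u"
      by (simp_all add: mat3_simps)
    then show "v = x" using \<open>?R\<close> by (auto simp: mult.commute)
  qed
qed

lemma indecomposable_Theta2_module_iff:
  "indecomposable (Theta2_module a b c d e) \<longleftrightarrow> (c \<noteq> 0 \<and> e = a) \<or> (d \<noteq> 0 \<and> e = a)"
  unfolding Theta2_module_def
  by (rule indecomposable_E12_triangular_iff) (rule sjp_relations_families)

lemma indecomposable_Theta4_module_iff:
  "indecomposable (Theta4_module a b c d e) \<longleftrightarrow> (c \<noteq> 0 \<and> e = a) \<or> (d \<noteq> 0 \<and> e = - a)"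
  unfolding Theta4_module_def
  by (rule indecomposable_E12_triangular_iff) (rule sjp_relations_families)

text \<open>Only the entry b has to be removed. With unit diagonal and y = 0, entry (1,2) requires
  \<open>b + z * d = c * u\<close>, solvable because c or d is nonzero.\<close>

lemma Theta2_module_iso_T_module:
  fixes a b c d :: "'k::field"
  assumes "c \<noteq> 0 \<or> d \<noteq> 0"
  shows "Theta2_module a b c d a \<simeq>\<^sub>M T_module a c d"
proof -
  have "\<exists>z u. b + z * d = c * u"
  proof (cases "c = 0")
    case True
    then have "b + (- b / d) * d = c * 0" using assms by simp
    then show ?thesis by blast
  next
    case False
    then have "b + 0 * d = c * (b / c)" by simp
    then show ?thesis by blast
  qed
  then obtain z u where "b + z * d = c * u" by blast
  then show ?thesis
    unfolding Theta2_module_def T_module_def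
      E12_module_iso_iff[OF sjp_relations_families(3) sjp_relations_families(3)]
    by (intro exI[of _ 1] exI[of _ 0] exI[of _ z] exI[of _ u] exI[of _ 1])
      (simp add: mat3_simps algebra_simps)
qed

section \<open>Normal forms in the family \<open>Theta4\<close>\<close>

lemma sjp_relations_V:
  fixes a :: "'k::field"
  shows "sjp_relations E12 (mat3 a 0 1 0 (- a) 0 0 0 a)"
    and "sjp_relations E12 (mat3 a 0 0 0 (- a) 0 0 1 (- a))"
  by (rule sjp_relations_families)+

text \<open>Taking v = c scales entry (1,3) to 1. The distinct eigenvalues a and -a allow d and then
  b to be cleared: u solves entry (3,2) and y solves entry (1,2), each dividing by their difference
  \<open>2 * a\<close>.\<close>

lemma Theta4_module_iso_upper_V:
  fixes a b c d :: "'k::field_char_0"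
  assumes "a \<noteq> 0" "c \<noteq> 0"
  shows "Theta4_module a b c d a \<simeq>\<^sub>M upper_V a"
proof -
  define u where "u = c * d / (2 * a)"
  define y where "y = (b - u) / (2 * a)"
  have u: "c * d = a * u + a * u" and y: "b = a * y + a * y + u"
    using assms(1) by (simp_all add: u_def y_def)
  have "mat3 1 y 0 0 1 0 0 u c ** mat3 a b c 0 (- a) 0 0 d a =
      mat3 a 0 1 0 (- a) 0 0 0 a ** mat3 1 y 0 0 1 0 0 u c"
    by (simp add: mat3_mult mat3_eq_iff u y)
  with assms(2) show ?thesis
    unfolding Theta4_module_def upper_V_def
      E12_module_iso_iff[OF sjp_relations_families(5) sjp_relations_V(1)]
    by (metis one_neq_zero)
qed

text \<open>Taking v = 1 / d scales entry (3,2) to 1; z clears c through entry (1,3), and y then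
  clears b through entry (1,2).\<close>

lemma Theta4_module_iso_lower_V:
  fixes a b c d :: "'k::field_char_0"
  assumes "a \<noteq> 0" "d \<noteq> 0"
  shows "Theta4_module a b c d (- a) \<simeq>\<^sub>M lower_V a"
proof -
  define z where "z = c / (2 * a)"
  define y where "y = (b + z * d) / (2 * a)"
  have z: "c = a * z + a * z" and y: "b = a * y + a * y - z * d"
    using assms(1) by (simp_all add: z_def y_def)
  have "mat3 1 y z 0 1 0 0 0 (1 / d) ** mat3 a b c 0 (- a) 0 0 d (- a) =
      mat3 a 0 0 0 (- a) 0 0 1 (- a) ** mat3 1 y z 0 1 0 0 0 (1 / d)"
    using assms(2) by (simp add: mat3_mult mat3_eq_iff z y mult.commute)
  moreover have "1 / d \<noteq> 0" using assms(2) by simp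
  ultimately show ?thesis
    unfolding Theta4_module_def lower_V_def
      E12_module_iso_iff[OF sjp_relations_families(5) sjp_relations_V(2)]
    by (metis one_neq_zero)
qed

text \<open>Entry (1,1) always yields a = a'. In the mixed case entry (3,3) adds a = -a', and the
  conclusion \<open>a = - a\<close> becomes a contradiction once a is nonzero in characteristic
  0.\<close>

lemma V_module_isoD:
  fixes a a' :: "'k::field"
  shows "upper_V a \<simeq>\<^sub>M upper_V a' \<Longrightarrow> a = a'"
    and "lower_V a \<simeq>\<^sub>M lower_V a' \<Longrightarrow> a = a'"
    and "upper_V a \<simeq>\<^sub>M lower_V a' \<Longrightarrow> a = - a"
proof -
  assume "upper_V a \<simeq>\<^sub>M upper_V a'"
  then show "a = a'"
    unfolding upper_V_def E12_module_iso_iff[OF sjp_relations_V(1) sjp_relations_V(1)]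
      mat3_mult mat3_eq_iff by (auto simp: mult.commute)
next
  assume "lower_V a \<simeq>\<^sub>M lower_V a'"
  then show "a = a'"
    unfolding lower_V_def E12_module_iso_iff[OF sjp_relations_V(2) sjp_relations_V(2)]
      mat3_mult mat3_eq_iff by (auto simp: mult.commute)
next
  assume "upper_V a \<simeq>\<^sub>M lower_V a'"
  then obtain x y z u v where "x \<noteq> 0" "v \<noteq> 0" and
    eq: "mat3 x y z 0 x 0 0 u v ** mat3 a 0 1 0 (- a) 0 0 0 a =
     mat3 a' 0 0 0 (- a') 0 0 1 (- a') ** mat3 x y z 0 x 0 0 u v"
    unfolding upper_V_def lower_V_def E12_module_iso_iff[OF sjp_relations_V(1) sjp_relations_V(2)]
    by blast
  have "x * a = a' * x" using arg_cong[OF eq, of "\<lambda>A. A $ 1 $ 1"] by (simp add: mat3_mult)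
  moreover have "v * a = - a' * v" using arg_cong[OF eq, of "\<lambda>A. A $ 3 $ 3"] by (simp add: mat3_mult)
  ultimately have "a = a'" "a = - a'"
    using \<open>x \<noteq> 0\<close> \<open>v \<noteq> 0\<close> by (metis mult.commute mult_cancel_left)+
  then show "a = - a" by simp
qed

text \<open>The relations force the entry \<open>p\<close> of \<open>x\<^sub>2\<close> in position \<open>(2, 1)\<close> to vanish, and then
  the product of the entries \<open>q\<close>, \<open>r\<close> in positions \<open>(2, 3)\<close>, \<open>(3, 1)\<close>; the families are the
  cases \<open>q \<noteq> 0\<close>, \<open>r \<noteq> 0\<close> and \<open>q = r = 0\<close>.\<close>

lemma E12_module_cases:
  fixes X :: "'k::field^3^3"
  assumes rel: "sjp_relations E12 X"
  obtains (Y) a b c d e where "e \<noteq> 0" "mat_module E12 X = Y_module a b c d e"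
  | (Theta2) a b c d e where "mat_module E12 X = Theta2_module a b c d e"
  | (W) a b c d e where "d \<noteq> 0" "mat_module E12 X = W_module a b c d e"
  | (Theta4) a b c d e where "a \<noteq> 0" "mat_module E12 X = Theta4_module a b c d e"
proof -
  obtain a b c p s q r t e where X: "X = mat3 a b c p s q r t e" by (rule mat3_exhaust)
  have eqs: "p * (a + s) + q * r = 0" "r * (a + e) + p * t = 0" "q * (s + e) + p * c = 0"
    "(a + s) * (a - s) + c * r - q * t = p"
  proof -
    define X21 where "X21 = X ** E12 + E12 ** X"
    have "X ** X21 = X21 ** X + E12 ** X21"
      using rel by (simp add: sjp_relations_def Let_def X21_def)
    then have entry: "(X ** X21) $ i $ j = (X21 ** X + E12 ** X21) $ i $ j" for i j by simp
    show "p * (a + s) + q * r = 0"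
      using entry[of 2 2] by (simp add: X X21_def E12_def mat3_mult mat3_add algebra_simps)
    show "r * (a + e) + p * t = 0"
      using entry[of 3 2] by (simp add: X X21_def E12_def mat3_mult mat3_add algebra_simps)
    show "q * (s + e) + p * c = 0"
      using entry[of 1 3] by (simp add: X X21_def E12_def mat3_mult mat3_add algebra_simps)
    show "(a + s) * (a - s) + c * r - q * t = p"
      using entry[of 1 2] by (simp add: X X21_def E12_def mat3_mult mat3_add algebra_simps)
  qed
  \<comment> \<open>Multiplied by p, the left side of the fourth relation becomes a combination of
    the first three, which vanish. This leaves \<open>p * p = 0\<close>.\<close>
  have "p * ((a + s) * (a - s) + c * r - q * t) =
      (p * (a + s) + q * r) * (a - s) + r * (q * (s + e) + p * c) - q * (r * (a + e) + p * t)"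
    by (simp add: algebra_simps)
  then have "p * p = 0" unfolding eqs by simp
  then have p: "p = 0" by simp
  consider "q \<noteq> 0" "r = 0" | "r \<noteq> 0" "q = 0" | "q = 0" "r = 0" using eqs(1) p by auto
  then show thesis
  proof cases
    case 1
    then have "s + e = 0" "(a + s) * (a - s) = q * t" using eqs p by simp_all
    then have "e = - s" "t = (a^2 - s^2) / q"
      using 1 by (simp_all add: add_eq_0_iff power2_eq_square square_diff_square_factored)
    then have "mat_module E12 X = Y_module a b c s q" by (simp add: Y_module_def X p 1)
    with 1 show thesis by (intro Y)
  next
    case 2
    then have "a + e = 0" using eqs(2) p by simp
    moreover have "(s + a) * (s - a) = c * r" using eqs(4) p 2 by (simp add: algebra_simps)
    ultimately have "e = - a" "c = (s^2 - a^2) / r"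
      using 2 by (simp_all add: add_eq_0_iff power2_eq_square square_diff_square_factored)
    then have "mat_module E12 X = W_module a b s r t" by (simp add: W_module_def X p 2)
    with 2 show thesis by (intro W)
  next
    case 3
    then have "s = a \<or> s = - a" using eqs(4) p by (auto simp: add_eq_0_iff)
    then show thesis
    proof (cases "s = a")
      case True
      then have "mat_module E12 X = Theta2_module a b c t e" by (simp add: Theta2_module_def X p 3)
      then show thesis by (rule Theta2)
    next
      case False
      then have s: "s = - a" "a \<noteq> 0" using \<open>s = a \<or> s = - a\<close> by auto
      then have "mat_module E12 X = Theta4_module a b c t e" by (simp add: Theta4_module_def X p 3)
      with s show thesis by (intro Theta4)
    qed
  qed
qed


section \<open>Conjugacy normal forms\<close>

lemma matrix_add_rdistrib: "(A + B) ** C = A ** C + B ** C"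
  by (simp add: vec_eq_iff matrix_matrix_mult_def sum.distrib algebra_simps)

lemma conjugate_matrix_inverse:
  fixes A B P :: "'k::field^'n^'n"
  assumes "invertible P" "A ** P = P ** B"
  obtains Q where "invertible Q" "Q ** A = B ** Q"
proof -
  obtain Q where Q: "P ** Q = mat 1" "Q ** P = mat 1" using assms(1) by (auto simp: invertible_def)
  have "Q ** A = Q ** (A ** P) ** Q"
    by (metis Q(1) matrix_mul_assoc matrix_mul_rid)
  also have "\<dots> = B ** Q" unfolding assms(2) by (metis Q(2) matrix_mul_assoc matrix_mul_lid)
  finally show thesis using that Q by (auto simp: invertible_def)
qed

lemma mat3_vector_mult:
  "(mat3 a11 a12 a13 a21 a22 a23 a31 a32 a33 *v x) $ 1 = a11 * x$1 + a12 * x$2 + a13 * x$3"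
  "(mat3 a11 a12 a13 a21 a22 a23 a31 a32 a33 *v x) $ 2 = a21 * x$1 + a22 * x$2 + a23 * x$3"
  "(mat3 a11 a12 a13 a21 a22 a23 a31 a32 a33 *v x) $ 3 = a31 * x$1 + a32 * x$2 + a33 * x$3"
  by (simp_all add: matrix_vector_mult_def sum_3)

lemma matrix_of_columns:
  fixes u v w :: "'k::field^3"
  assumes indep: "\<And>a b c. a *s u + b *s v + c *s w = 0 \<Longrightarrow> a = 0 \<and> b = 0 \<and> c = 0"
  obtains P :: "'k^3^3" where
    "invertible P" "\<And>x. P *v x = x$1 *s u + x$2 *s v + x$3 *s w"
proof -
  define f where "f x = x$1 *s u + x$2 *s v + x$3 *s w" for x :: "'k^3"
  obtain P where P: "\<And>x. f x = P *v x"
    using linear_matrix_exists[of f]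
    by (auto simp: f_def vec.scale_left_distrib vec.scale_right_distrib algebra_simps)
  have "x = 0" if "P *v x = 0" for x
    using indep that by (simp add: vec_eq_iff[of x] forall_3 f_def flip: P)
  then have "invertible P" by (simp add: invertible_left_inverse matrix_left_invertible_ker)
  moreover note P[symmetric, unfolded f_def]
  ultimately show thesis by (rule that)
qed

text \<open>Reads off \<open>B\<close> as the matrix of \<open>A\<close> in the basis u, v,
  w.\<close>

lemma conjugate_matrix_basis:
  fixes A B :: "'k::field^3^3" and u v w :: "'k^3"
  assumes indep: "\<And>a b c. a *s u + b *s v + c *s w = 0 \<Longrightarrow> a = 0 \<and> b = 0 \<and> c = 0"
    and AB: "\<And>x. A *v (x$1 *s u + x$2 *s v + x$3 *s w) =
      (B *v x)$1 *s u + (B *v x)$2 *s v + (B *v x)$3 *s w"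
  obtains Q where "invertible Q" "Q ** A = B ** Q"
proof -
  obtain P :: "'k^3^3" where "invertible P" "\<And>x. P *v x = x$1 *s u + x$2 *s v + x$3 *s w"
    using matrix_of_columns[OF indep] by blast
  moreover from this have "A ** P = P ** B"
    using AB by (simp add: matrix_eq flip: matrix_vector_mul_assoc)
  ultimately show thesis using conjugate_matrix_inverse that by blast
qed

text \<open>Complete w = Av, nonzero, and v to a basis by some z. As \<open>A\<close> squares to
  zero, Az must be a multiple \<open>a *s w\<close>, and replacing z by \<open>z - a *s v\<close>
  moves it into the kernel. In the resulting basis only v is not killed.\<close>

lemma square_zero_conjugate_E12:
  fixes A :: "'k::field^3^3"
  assumes "A ** A = 0" "A \<noteq> 0"
  obtains Q where "invertible Q" "Q ** A = E12 ** Q"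
proof -
  have AA: "A *v (A *v x) = 0" for x using assms(1) by (simp add: matrix_vector_mul_assoc)
  obtain v where v: "A *v v \<noteq> 0" using assms(2) by (auto simp: matrix_eq)
  define w where "w = A *v v"
  have w: "w \<noteq> 0" "A *v w = 0" "A *v v = w" using v AA by (simp_all add: w_def)
  have "vec.dim {w, v} \<le> card {w, v}" by (rule vec.dim_le_card') simp
  also have "\<dots> \<le> 2" by (simp add: card_insert_if)
  finally have dim: "vec.dim {w, v} \<le> 2" .
  have "vec.span {w, v} \<noteq> UNIV"
  proof
    assume "vec.span {w, v} = UNIV"
    then have "vec.dim {w, v} = CARD(3)" by (metis vec.dim_span vec_dim_card)
    with dim show False by simp
  qed
  then obtain z where z: "z \<notin> vec.span {w, v}" by blast
  have indep: "a = 0 \<and> b = 0 \<and> c = 0" if "a *s w + b *s v + c *s z = 0" for a b c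
  proof -
    have "c = 0"
    proof (rule ccontr)
      assume "c \<noteq> 0"
      have "c *s z = - (a *s w + b *s v)"
        using that by (metis add.commute eq_neg_iff_add_eq_0)
      also have "\<dots> \<in> vec.span {w, v}"
        by (intro vec.span_neg vec.span_add vec.span_scale vec.span_base) simp_all
      finally have "(1 / c) *s (c *s z) \<in> vec.span {w, v}" by (rule vec.span_scale)
      with z \<open>c \<noteq> 0\<close> show False by simp
    qed
    moreover from this have "a *s w + b *s v = 0" using that by simp
    then have "A *v (a *s w + b *s v) = 0" by simp
    then have "b = 0" using w by (simp add: matrix_vector_right_distrib vector_scalar_commute)
    ultimately show ?thesis using that w by simp
  qed
  obtain P :: "'k^3^3" where P: "invertible P" "\<And>x. P *v x = x$1 *s w + x$2 *s v + x$3 *s z"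
    using matrix_of_columns[of w v z] indep by blast
  have "\<exists>x. A *v z = P *v x"
    by (metis P(1) invertible_def matrix_vector_mul_assoc matrix_vector_mul_lid)
  then obtain a b c where Az: "A *v z = a *s w + b *s v + c *s z" unfolding P(2) by blast
  have "A *v (a *s w + b *s v + c *s z) = 0" using AA[of z] by (simp add: Az)
  \<comment> \<open>The coefficient of z gives c = 0, and that of w then gives b = 0.\<close>
  then have "(c * a + b) *s w + (c * b) *s v + (c * c) *s z = 0"
    by (simp add: matrix_vector_right_distrib vector_scalar_commute w Az vec.scale_left_distrib
        vec.scale_right_distrib algebra_simps)
  then have "b = 0" "c = 0" using indep[of "c * a + b" "c * b" "c * c"] by auto
  define u where "u = z - a *s v"
  have Au: "A *v u = 0"
    by (simp add: u_def Az \<open>b = 0\<close> \<open>c = 0\<close> w matrix_vector_mult_diff_distrib vector_scalar_commute)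
  have indep': "p = 0 \<and> q = 0 \<and> r = 0" if "p *s w + q *s v + r *s u = 0" for p q r
  proof -
    have "p *s w + (q - r * a) *s v + r *s z = 0"
      using that by (simp add: u_def vec.scale_right_diff_distrib vec.scale_left_diff_distrib
          algebra_simps)
    then show ?thesis using indep[of p "q - r * a" r] by auto
  qed
  show thesis
    by (rule conjugate_matrix_basis[of w v u A E12])
      (use indep' that in \<open>auto simp: E12_def mat3_vector_mult matrix_vector_right_distrib
        vector_scalar_commute w Au\<close>)
qed

text \<open>A vector v not killed by the square of \<open>A\<close> is cyclic, and its chain is the
  Jordan basis. Independence follows by applying \<open>A\<close> twice, then once.\<close>

lemma cube_zero_conjugate:
  fixes A :: "'k::field^3^3"
  assumes "A ** (A ** A) = 0" "A ** A \<noteq> 0"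
  obtains Q where "invertible Q" "Q ** A = mat3 0 1 0 0 0 1 0 0 0 ** Q"
proof -
  have AAA: "A *v (A *v (A *v x)) = 0" for x
    using assms(1) by (simp add: matrix_vector_mul_assoc matrix_mul_assoc)
  obtain v where v: "A *v (A *v v) \<noteq> 0"
    using assms(2) by (auto simp: matrix_eq simp flip: matrix_vector_mul_assoc)
  have indep: "a = 0 \<and> b = 0 \<and> c = 0"
    if abc: "a *s (A *v (A *v v)) + b *s (A *v v) + c *s v = 0" for a b c
  proof -
    have "A *v (A *v (a *s (A *v (A *v v)) + b *s (A *v v) + c *s v)) = 0" by (simp add: abc)
    then have "c = 0"
      using v by (simp add: matrix_vector_right_distrib vector_scalar_commute AAA)
    moreover have "A *v (a *s (A *v (A *v v)) + b *s (A *v v) + c *s v) = 0" by (simp add: abc)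
    then have "b = 0"
      using v \<open>c = 0\<close> by (simp add: matrix_vector_right_distrib vector_scalar_commute AAA)
    ultimately show ?thesis using abc v by simp
  qed
  show thesis
    by (rule conjugate_matrix_basis[of "A *v (A *v v)" "A *v v" v A "mat3 0 1 0 0 0 1 0 0 0"])
      (use indep that in \<open>auto simp: mat3_vector_mult matrix_vector_right_distrib
        vector_scalar_commute AAA\<close>)
qed

text \<open>Sum of the principal 2 x 2 minors: the linear coefficient of the monic characteristic
  polynomial.\<close>

definition minor_sum :: "'k::field^3^3 \<Rightarrow> 'k" where
  "minor_sum A = A$1$1 * A$2$2 - A$1$2 * A$2$1 + A$1$1 * A$3$3 - A$1$3 * A$3$1
     + A$2$2 * A$3$3 - A$2$3 * A$3$2"

lemma cayley_hamilton_3: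
  fixes A :: "'k::field^3^3"
  shows "A *v (A *v (A *v x)) =
    trace A *s (A *v (A *v x)) - minor_sum A *s (A *v x) + det A *s x"
proof -
  obtain a11 a12 a13 a21 a22 a23 a31 a32 a33
    where A: "A = mat3 a11 a12 a13 a21 a22 a23 a31 a32 a33" by (rule mat3_exhaust)
  show ?thesis
    by (simp add: vec_eq_iff forall_3 A mat3_vector_mult trace_def sum_3 minor_sum_def det_3
        algebra_simps)
qed

text \<open>Newton's identity. It forces the trace to vanish when \<open>A ** A = 0\<close> and
  \<open>minor_sum A = 0\<close>.\<close>

lemma trace_square_3:
  fixes A :: "'k::field^3^3"
  shows "trace (A ** A) = trace A * trace A - (minor_sum A + minor_sum A)"
proof -
  obtain a11 a12 a13 a21 a22 a23 a31 a32 a33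
    where A: "A = mat3 a11 a12 a13 a21 a22 a23 a31 a32 a33" by (rule mat3_exhaust)
  show ?thesis
    by (simp add: A mat3_mult trace_def sum_3 minor_sum_def algebra_simps)
qed

lemma eigenvalue_exists_3:
  fixes A :: "'k::alg_closed_field^3^3"
  obtains l where "det (A - mat l) = 0"
proof -
  let ?p = "[:det A, - minor_sum A, trace A, - 1:]"
  have "poly ?p l = det (A - mat l)" for l
  proof -
    obtain a11 a12 a13 a21 a22 a23 a31 a32 a33
      where A: "A = mat3 a11 a12 a13 a21 a22 a23 a31 a32 a33" by (rule mat3_exhaust)
    show ?thesis
      by (simp add: A mat_eq_mat3 mat3_diff trace_def sum_3 minor_sum_def det_3 algebra_simps)
  qed
  moreover have "\<exists>l. poly ?p l = 0" by (rule alg_closed_imp_poly_has_root) simp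
  ultimately show thesis using that by auto
qed

section \<open>Modules on which x1 acts by zero\<close>

lemma sjp_relations_zero: "sjp_relations 0 X"
  by (simp add: sjp_relations_def Let_def)

text \<open>With t and s the trace and the minor sum, the characteristic polynomial is X (X^2 - t X
  + s). For s nonzero, 0 is a simple root and (A^2 - t A + s) / s projects onto the kernel. For s =
  0 it is X^2 (X - t), and A^2 / t^2 projects onto the eigenspace of t.\<close>

lemma idempotent_of_singular_matrix:
  fixes A :: "'k::field^3^3"
  assumes det: "det A = 0" and not_nilpotent: "trace A \<noteq> 0 \<or> minor_sum A \<noteq> 0"
  obtains E where "E ** E = E" "E ** A = A ** E" "E \<noteq> 0" "E \<noteq> mat 1"
proof -
  define t where "t = trace A"
  define s where "s = minor_sum A"
  have CH: "A *v (A *v (A *v x)) = t *s (A *v (A *v x)) - s *s (A *v x)" for x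
    using cayley_hamilton_3[of A x] by (simp add: det t_def s_def)
  obtain x0 where x0: "x0 \<noteq> 0" "A *v x0 = 0"
    using det invertible_det_nz[of A] by (auto simp: invertible_left_inverse matrix_left_invertible_ker)
  note mv = matrix_vector_right_distrib matrix_vector_mult_diff_distrib vector_scalar_commute
  show thesis
  proof (cases "s = 0")
    case False
    define q where "q x = A *v (A *v x) - t *s (A *v x) + s *s x" for x
    define e where "e x = (1 / s) *s q x" for x
    have Aq: "A *v q x = 0" for x by (simp add: q_def mv CH)
    \<comment> \<open>\<open>A\<close> kills the image of \<open>q\<close>, so only the constant
      term s of \<open>q\<close> acts there.\<close>
    have qq: "q (q x) = s *s q x" for x by (simp add: q_def[of "q x"] Aq)
    have q_lin: "q (x + y) = q x + q y" "q (c *s x) = c *s q x" for x y c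
      by (simp_all add: q_def mv vec.scale_right_distrib vec.scale_right_diff_distrib mult.commute)
    obtain E where E: "\<And>x. e x = E *v x"
      using linear_matrix_exists[of e]
      by (auto simp: e_def q_lin vec.scale_right_distrib mult.commute)
    show thesis
    proof (rule that)
      show "E ** E = E"
        using False by (simp add: matrix_eq e_def q_lin qq flip: matrix_vector_mul_assoc E)
      have "q (A *v x) = 0" for x by (simp add: q_def CH)
      then show "E ** A = A ** E"
        by (simp add: matrix_eq e_def Aq vector_scalar_commute flip: matrix_vector_mul_assoc E)
      have "E *v x0 = x0" using False x0 by (simp add: e_def q_def flip: E)
      then show "E \<noteq> 0" using x0 by auto
      show "E \<noteq> mat 1"
      proof
        assume "E = mat 1"
        then have "s *s e x = s *s x" for x by (simp add: E)
        then have "q x = s *s x" for x using False by (simp add: e_def)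
        then have "A *v x = 0" for x using Aq[of x] False by (simp add: mv)
        then have "A = 0" by (simp add: matrix_eq)
        then show False using False by (simp add: s_def minor_sum_def)
      qed
    qed
  next
    case True
    then have t: "t \<noteq> 0" using not_nilpotent by (simp add: t_def s_def)
    define e where "e x = (1 / (t * t)) *s (A *v (A *v x))" for x
    have CH': "A *v (A *v (A *v x)) = t *s (A *v (A *v x))" for x using CH True by simp
    obtain E where E: "\<And>x. e x = E *v x"
      using linear_matrix_exists[of e]
      by (auto simp: e_def mv vec.scale_right_distrib mult.commute)
    show thesis
    proof (rule that)
      show "E ** E = E"
        using t by (simp add: matrix_eq e_def mv CH' flip: matrix_vector_mul_assoc E)
      show "E ** A = A ** E"
        by (simp add: matrix_eq e_def mv flip: matrix_vector_mul_assoc E)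
      show "E \<noteq> mat 1" using x0 E[of x0] by (auto simp: e_def)
      show "E \<noteq> 0"
      proof
        assume "E = 0"
        then have "A *v (A *v x) = 0" for x using E[of x] t by (simp add: e_def)
        then have "A ** A = 0" by (simp add: matrix_eq flip: matrix_vector_mul_assoc)
        then have "t * t = 0"
          using trace_square_3[of A] True by (simp add: t_def s_def trace_def)
        then show False using t by simp
      qed
    qed
  qed
qed

text \<open>Translating x2 by an eigenvalue changes neither the commutant nor conjugacy, so the
  singular matrix \<open>N\<close> can be studied instead. Indecomposability makes it nilpotent, and
  a nonzero square makes it a single block.\<close>

lemma indecomposable_zero_module:
  fixes X :: "'k::alg_closed_field^3^3"
  assumes ind: "indecomposable (mat_module 0 X)"
  obtains l where "mat_module 0 X \<simeq>\<^sub>M jordan_module l"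
proof -
  obtain l where l: "det (X - mat l) = 0" by (rule eigenvalue_exists_3)
  define N where "N = X - mat l"
  have X: "X = N + mat l" by (simp add: N_def)
  have "mat c *v x = c *s x" for c and x :: "'k^3"
    by (simp add: vec_eq_iff forall_3 mat_eq_mat3 mat3_vector_mult)
  then have mat_comm: "P ** mat c = mat c ** P" for P :: "'k^3^3" and c
    by (simp add: matrix_eq vector_scalar_commute flip: matrix_vector_mul_assoc)
  have conj_X: "Q ** X = (B + mat l) ** Q" if "Q ** N = B ** Q" for Q B :: "'k^3^3"
    by (simp add: X matrix_add_ldistrib matrix_add_rdistrib that mat_comm)
  have iso: "mat_module 0 X \<simeq>\<^sub>M mat_module 0 (B + mat l)" if "invertible Q" "Q ** N = B ** Q"
    for Q B :: "'k^3^3"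
    using that conj_X by (auto simp: mat_module_iso_iff sjp_relations_zero)
  have no_idem: "E = 0 \<or> E = mat 1" if "E ** E = E" "E ** N = N ** E" for E
  proof -
    have "E ** X = X ** E" by (simp add: X matrix_add_ldistrib matrix_add_rdistrib that mat_comm)
    then show ?thesis
      using ind that(1) by (simp add: indecomposable_mat_module_iff sjp_relations_zero)
  qed
  have "trace N = 0" "minor_sum N = 0"
    using idempotent_of_singular_matrix[of N] no_idem l by (auto simp: N_def)
  then have cube: "N ** (N ** N) = 0"
    using cayley_hamilton_3[of N] l
    by (simp add: matrix_eq N_def[symmetric] flip: matrix_vector_mul_assoc)
  have "N ** N \<noteq> 0"
  proof
    assume "N ** N = 0"
    \<comment> \<open>The projection onto the third coordinate commutes with 0 and with
      \<open>E12\<close>, the two normal forms of square zero, and so splits the module in both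
      cases.\<close>
    let ?F = "mat3 0 0 0 0 0 0 0 0 1 :: 'k^3^3"
    have F: "?F ** ?F = ?F" "?F \<noteq> 0" "?F \<noteq> mat 1" "?F ** E12 = E12 ** ?F"
      by (simp_all add: mat3_simps E12_def)
    show False
    proof (cases "N = 0")
      case True
      then show False using no_idem[of ?F] F by simp
    next
      case False
      with \<open>N ** N = 0\<close> obtain Q where "invertible Q" "Q ** N = E12 ** Q"
        by (rule square_zero_conjugate_E12)
      then have "indecomposable (mat_module 0 (E12 + mat l))" using iso ind indecomposable_iso by blast
      then have "?F = 0 \<or> ?F = mat 1" if "?F ** (E12 + mat l) = (E12 + mat l) ** ?F"
        using that F(1) unfolding indecomposable_mat_module_iff[OF sjp_relations_zero]
        by simp
      moreover have "?F ** (E12 + mat l) = (E12 + mat l) ** ?F"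
        by (simp add: matrix_add_ldistrib matrix_add_rdistrib F mat_comm)
      ultimately show False
        using F(2,3) by simp
    qed
  qed
  with cube obtain Q where "invertible Q" "Q ** N = mat3 0 1 0 0 0 1 0 0 0 ** Q"
    by (rule cube_zero_conjugate)
  then have "mat_module 0 X \<simeq>\<^sub>M mat_module 0 (mat3 0 1 0 0 0 1 0 0 0 + mat l)" by (rule iso)
  then show thesis by (intro that[of l]) (simp add: jordan_module_def mat_eq_mat3 mat3_add)
qed

text \<open>For distinct eigenvalues the first column of an intertwiner vanishes from the bottom up,
  so it is singular.\<close>

lemma jordan_module_isoD:
  fixes l l' :: "'k::field"
  assumes "jordan_module l \<simeq>\<^sub>M jordan_module l'"
  shows "l = l'"
proof (rule ccontr)
  assume neq: "l \<noteq> l'"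
  obtain P where P: "invertible P"
    "P ** mat3 l 1 0 0 l 1 0 0 l = mat3 l' 1 0 0 l' 1 0 0 l' ** P"
    using assms unfolding jordan_module_def by (auto simp: mat_module_iso_iff sjp_relations_zero)
  obtain a11 a12 a13 a21 a22 a23 a31 a32 a33
    where m: "P = mat3 a11 a12 a13 a21 a22 a23 a31 a32 a33" by (rule mat3_exhaust)
  have eqs: "a31 * l = l' * a31" "a21 * l = l' * a21 + a31" "a11 * l = l' * a11 + a21"
    using P(2) unfolding m mat3_mult mat3_eq_iff by simp_all
  have "a31 = 0" using eqs(1) neq by (auto simp: mult.commute)
  moreover from this have "a21 = 0" using eqs(2) neq by (auto simp: mult.commute)
  moreover from this have "a11 = 0" using eqs(3) neq by (auto simp: mult.commute)
  ultimately show False using P(1) by (simp add: m invertible_mat3)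
qed

lemma not_iso_jordan_module:
  fixes X :: "'k::field^3^3"
  assumes "sjp_relations E12 X"
  shows "\<not> jordan_module l \<simeq>\<^sub>M mat_module E12 X"
proof
  assume "jordan_module l \<simeq>\<^sub>M mat_module E12 X"
  then obtain P :: "'k^3^3" where "invertible P" "P ** (0 :: 'k^3^3) = E12 ** P"
    unfolding jordan_module_def mat_module_iso_iff[OF sjp_relations_zero assms] by blast
  then obtain Q where "P ** Q = mat 1" "E12 ** P = 0" by (auto simp: invertible_def)
  then have "E12 ** (P ** Q) = 0" unfolding matrix_mul_assoc by simp
  then have "E12 = (0 :: 'k^3^3)" unfolding \<open>P ** Q = mat 1\<close> by simp
  then show False by (simp add: E12_def mat3_simps)
qed


section \<open>The classification\<close>

lemma indecomposable_sjp_dim_3_cases: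
  fixes M :: "'k::alg_closed_field sjp \<Rightarrow> 'v::ab_group_add \<Rightarrow> 'v"
  assumes "indecomposable M" "sjp_dim M = 3"
  obtains (jordan) l where "M \<simeq>\<^sub>M jordan_module l"
  | (E12) X where "sjp_relations E12 X" "indecomposable (mat_module E12 X)" "M \<simeq>\<^sub>M mat_module E12 X"
proof -
  obtain X1 X2 where X: "sjp_relations X1 X2" "M \<simeq>\<^sub>M mat_module X1 X2"
    using mat_module_iso_exists assms by (metis indecomposable_def)
  then have ind: "indecomposable (mat_module X1 X2)" using indecomposable_iso assms(1) by blast
  show thesis
  proof (cases "X1 = 0")
    case True
    with ind obtain l where "mat_module X1 X2 \<simeq>\<^sub>M jordan_module l"
      using indecomposable_zero_module by blast
    then show thesis using X(2) module_iso_trans jordan by blast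
  next
    case False
    moreover have "X1 ** X1 = 0" using X(1) by (simp add: sjp_relations_def)
    ultimately obtain P where "invertible P" "P ** X1 = E12 ** P"
      by (metis square_zero_conjugate_E12)
    with X(1) obtain X where "sjp_relations E12 X" "mat_module X1 X2 \<simeq>\<^sub>M mat_module E12 X"
      using mat_module_conjugate by blast
    then show thesis using X(2) ind E12 indecomposable_iso module_iso_trans by blast
  qed
qed

lemma jordan_module_not_in_families:
  fixes a b c d e l :: "'k::field"
  shows "e \<noteq> 0 \<Longrightarrow> \<not> jordan_module l \<simeq>\<^sub>M Y_module a b c d e"
    and "\<not> jordan_module l \<simeq>\<^sub>M Theta2_module a b c d e"
    and "d \<noteq> 0 \<Longrightarrow> \<not> jordan_module l \<simeq>\<^sub>M W_module a b c d e"
    and "\<not> jordan_module l \<simeq>\<^sub>M Theta4_module a b c d e"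
  unfolding Y_module_def Theta2_module_def W_module_def Theta4_module_def
  by (rule not_iso_jordan_module, rule sjp_relations_families, assumption?)+

lemma indecomposable_dichotomy:
  fixes M :: "'k::{alg_closed_field, field_char_0} sjp \<Rightarrow> 'v::ab_group_add \<Rightarrow> 'v"
  assumes "indecomposable M" "sjp_dim M = 3"
  defines "in_families \<equiv>
    (\<exists>a b c d e. e \<noteq> 0 \<and> M \<simeq>\<^sub>M Y_module a b c d e) \<or>
    (\<exists>a b c d e. (c \<noteq> 0 \<and> e = a \<or> d \<noteq> 0 \<and> e = a) \<and> M \<simeq>\<^sub>M Theta2_module a b c d e) \<or>
    (\<exists>a b c d e. d \<noteq> 0 \<and> M \<simeq>\<^sub>M W_module a b c d e) \<or>
    (\<exists>a b c d e. a \<noteq> 0 \<and> (c \<noteq> 0 \<and> e = a \<or> d \<noteq> 0 \<and> e = - a) \<and> M \<simeq>\<^sub>M Theta4_module a b c d e)"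
  shows "(\<exists>!l. M \<simeq>\<^sub>M jordan_module l) \<and> \<not> in_families \<or>
    \<not> (\<exists>l. M \<simeq>\<^sub>M jordan_module l) \<and> in_families"
proof -
  \<comment> \<open>Membership in the families would pass along the isomorphism to a Jordan module,
    on which x1 acts by zero.\<close>
  have excl: "\<not> M \<simeq>\<^sub>M jordan_module l" if fam: in_families for l
  proof
    assume l: "M \<simeq>\<^sub>M jordan_module l"
    show False
      using fam unfolding in_families_def module_iso_cong_left[OF l]
      by (elim disjE exE conjE) (simp_all add: jordan_module_not_in_families)
  qed
  show ?thesis
  proof (cases rule: indecomposable_sjp_dim_3_cases[OF assms(1,2)])
    case (1 l)
    then have "l' = l" if "M \<simeq>\<^sub>M jordan_module l'" for l'
      using that by (metis jordan_module_isoD module_iso_cong_left)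
    with 1 excl show ?thesis by blast
  next
    case (2 X)
    have in_families
    proof (cases rule: E12_module_cases[OF 2(1)])
      case (1 a b c d e)
      then show ?thesis using 2(3) unfolding in_families_def by metis
    next
      case (2 a b c d e)
      then have "c \<noteq> 0 \<and> e = a \<or> d \<noteq> 0 \<and> e = a"
        using \<open>indecomposable (mat_module E12 X)\<close> by (simp add: indecomposable_Theta2_module_iff)
      then show ?thesis using 2 \<open>M \<simeq>\<^sub>M mat_module E12 X\<close> unfolding in_families_def by metis
    next
      case (3 a b c d e)
      then show ?thesis using 2(3) unfolding in_families_def by metis
    next
      case (4 a b c d e)
      then have "c \<noteq> 0 \<and> e = a \<or> d \<noteq> 0 \<and> e = - a"
        using \<open>indecomposable (mat_module E12 X)\<close> by (simp add: indecomposable_Theta4_module_iff)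
      then show ?thesis using 4 2(3) unfolding in_families_def by metis
    qed
    with excl show ?thesis by blast
  qed
qed

lemma Theta4_normal_form:
  fixes M :: "'k::field_char_0 sjp \<Rightarrow> 'k^3 \<Rightarrow> 'k^3"
  assumes "M \<in> Theta4" "indecomposable M"
  shows "(\<exists>!a. a \<noteq> 0 \<and> M \<simeq>\<^sub>M upper_V a) \<and> \<not> (\<exists>a. a \<noteq> 0 \<and> M \<simeq>\<^sub>M lower_V a) \<or>
    \<not> (\<exists>a. a \<noteq> 0 \<and> M \<simeq>\<^sub>M upper_V a) \<and> (\<exists>!a. a \<noteq> 0 \<and> M \<simeq>\<^sub>M lower_V a)"
proof -
  obtain a b c d e where a: "a \<noteq> 0" and M: "M = Theta4_module a b c d e"
    using assms(1) by (auto simp: Theta4_def)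
  \<comment> \<open>\<open>a' = - a'\<close> contradicts \<open>a' \<noteq> 0\<close> in
    characteristic 0.\<close>
  have mixed: "\<not> upper_V a' \<simeq>\<^sub>M lower_V a''" if "a' \<noteq> 0" for a' a'' :: 'k
    using V_module_isoD(3)[of a' a''] that by (auto simp: eq_neg_iff_add_eq_0)
  have "c \<noteq> 0 \<and> e = a \<or> d \<noteq> 0 \<and> e = - a"
    using assms(2) unfolding M by (simp add: indecomposable_Theta4_module_iff)
  then show ?thesis
  proof
    assume "c \<noteq> 0 \<and> e = a"
    then have "M \<simeq>\<^sub>M upper_V a" using Theta4_module_iso_upper_V a M by blast
    then have eq: "M \<simeq>\<^sub>M N \<longleftrightarrow> upper_V a \<simeq>\<^sub>M N" for N :: "'k sjp \<Rightarrow> 'k^3 \<Rightarrow> 'k^3"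
      by (rule module_iso_cong_left)
    have "\<exists>!a. a \<noteq> 0 \<and> M \<simeq>\<^sub>M upper_V a"
      using a \<open>M \<simeq>\<^sub>M upper_V a\<close> V_module_isoD(1) unfolding eq by blast
    then show ?thesis using mixed[OF a] unfolding eq by blast
  next
    assume "d \<noteq> 0 \<and> e = - a"
    then have "M \<simeq>\<^sub>M lower_V a" using Theta4_module_iso_lower_V a M by blast
    then have eq: "M \<simeq>\<^sub>M N \<longleftrightarrow> lower_V a \<simeq>\<^sub>M N" for N :: "'k sjp \<Rightarrow> 'k^3 \<Rightarrow> 'k^3"
      by (rule module_iso_cong_left)
    have "\<exists>!a. a \<noteq> 0 \<and> M \<simeq>\<^sub>M lower_V a"
      using a \<open>M \<simeq>\<^sub>M lower_V a\<close> V_module_isoD(2) unfolding eq by blast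
    then show ?thesis using mixed module_iso_sym unfolding eq by blast
  qed
qed

theorem theorem3p11:
  shows
   "(\<forall>M :: 'k::{alg_closed_field, field_char_0} sjp \<Rightarrow> 'v::ab_group_add \<Rightarrow> 'v.
       indecomposable M \<and> sjp_dim M = 3 \<longrightarrow>
       (let in_families =
          (\<exists>a b c d e. e \<noteq> 0 \<and> M \<simeq>\<^sub>M Y_module a b c d e) \<or>
          (\<exists>a b c d e. (c \<noteq> 0 \<and> e = a \<or> d \<noteq> 0 \<and> e = a) \<and> M \<simeq>\<^sub>M Theta2_module a b c d e) \<or>
          (\<exists>a b c d e. d \<noteq> 0 \<and> M \<simeq>\<^sub>M W_module a b c d e) \<or>
          (\<exists>a b c d e. a \<noteq> 0 \<and> (c \<noteq> 0 \<and> e = a \<or> d \<noteq> 0 \<and> e = - a) \<and>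
             M \<simeq>\<^sub>M Theta4_module a b c d e)
        in (\<exists>!l. M \<simeq>\<^sub>M jordan_module l) \<and> \<not> in_families \<or>
           \<not> (\<exists>l. M \<simeq>\<^sub>M jordan_module l) \<and> in_families))
    \<and>
    (\<forall>a b c d e :: 'k. e \<noteq> 0 \<longrightarrow> indecomposable (Y_module a b c d e)) \<and>
    (\<forall>a b c d e :: 'k. indecomposable (Theta2_module a b c d e) \<longleftrightarrow>
       (c \<noteq> 0 \<and> e = a) \<or> (d \<noteq> 0 \<and> e = a)) \<and>
    (\<forall>a b c d e :: 'k. d \<noteq> 0 \<longrightarrow> indecomposable (W_module a b c d e)) \<and>
    (\<forall>a b c d e :: 'k. a \<noteq> 0 \<longrightarrow>
       (indecomposable (Theta4_module a b c d e) \<longleftrightarrow>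
          (c \<noteq> 0 \<and> e = a) \<or> (d \<noteq> 0 \<and> e = - a)))
    \<and>
    (\<forall>M \<in> (Theta1 :: ('k sjp \<Rightarrow> 'k^3 \<Rightarrow> 'k^3) set). indecomposable M \<longrightarrow>
       (\<exists>a b. M \<simeq>\<^sub>M upper_U a b) \<or> (\<exists>a b c d e. e \<noteq> 0 \<and> M \<simeq>\<^sub>M Y_module a b c d e)) \<and>
    (\<forall>a b c d e b' c' d' e' :: 'k. e \<noteq> 0 \<and> e' \<noteq> 0 \<longrightarrow>
       (Y_module a b c d e \<simeq>\<^sub>M Y_module a b' c' d' e' \<longleftrightarrow>
          (a - d') * ((c * e' - c' * e) / e') = e * (b' - b) + c * (d - d'))) \<and>
    (\<forall>a b b' :: 'k. upper_U a b \<simeq>\<^sub>M upper_U a b' \<longleftrightarrow> b = b')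
    \<and>
    (\<forall>M \<in> (Theta2 :: ('k sjp \<Rightarrow> 'k^3 \<Rightarrow> 'k^3) set). indecomposable M \<longrightarrow>
       (\<exists>a. M \<simeq>\<^sub>M R_module a) \<or> (\<exists>a. M \<simeq>\<^sub>M S_module a) \<or>
       (\<exists>a b c. (b \<noteq> 0 \<or> c \<noteq> 0) \<and> M \<simeq>\<^sub>M T_module a b c)) \<and>
    (\<forall>a b c b' c' :: 'k. (b \<noteq> 0 \<or> c \<noteq> 0) \<and> (b' \<noteq> 0 \<or> c' \<noteq> 0) \<longrightarrow>
       (T_module a b c \<simeq>\<^sub>M T_module a b' c' \<longleftrightarrow>
          b * c = b' * c' \<and> (b = 0 \<longleftrightarrow> b' = 0) \<and> (c = 0 \<longleftrightarrow> c' = 0)))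
    \<and>
    (\<forall>M \<in> (Theta3 :: ('k sjp \<Rightarrow> 'k^3 \<Rightarrow> 'k^3) set). indecomposable M \<longrightarrow>
       (\<exists>a b. M \<simeq>\<^sub>M lower_U a b) \<or> (\<exists>a b c d e. d \<noteq> 0 \<and> M \<simeq>\<^sub>M W_module a b c d e)) \<and>
    (\<forall>a b c d e a' b' d' e' :: 'k. d \<noteq> 0 \<and> d' \<noteq> 0 \<longrightarrow>
       (W_module a b c d e \<simeq>\<^sub>M W_module a' b' c d' e' \<longleftrightarrow>
          (a * e - b * d - c * e) / d = (a' * e' - b' * d' - c * e') / d')) \<and>
    (\<forall>a b b' :: 'k. lower_U a b \<simeq>\<^sub>M lower_U a b' \<longleftrightarrow> b = b')
    \<and>
    (\<forall>M \<in> (Theta4 :: ('k sjp \<Rightarrow> 'k^3 \<Rightarrow> 'k^3) set). indecomposable M \<longrightarrow>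
       (\<exists>!a. a \<noteq> 0 \<and> M \<simeq>\<^sub>M upper_V a) \<and> \<not> (\<exists>a. a \<noteq> 0 \<and> M \<simeq>\<^sub>M lower_V a) \<or>
       \<not> (\<exists>a. a \<noteq> 0 \<and> M \<simeq>\<^sub>M upper_V a) \<and> (\<exists>!a. a \<noteq> 0 \<and> M \<simeq>\<^sub>M lower_V a))"
proof (intro conjI, goal_cases)
  case 1
  show ?case (is "\<forall>M. _ M \<longrightarrow> ?D M")
  proof (intro allI impI, elim conjE)
    fix M :: "'k sjp \<Rightarrow> 'v \<Rightarrow> 'v"
    assume "indecomposable M" "sjp_dim M = 3"
    then show "?D M" unfolding Let_def by (rule indecomposable_dichotomy)
  qed
next
  case 2
  show ?case by (intro allI impI indecomposable_Y_module)
next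
  case 3
  show ?case by (simp add: indecomposable_Theta2_module_iff)
next
  case 4
  show ?case by (intro allI impI indecomposable_W_module)
next
  case 5
  show ?case by (simp add: indecomposable_Theta4_module_iff)
next
  case 6
  show ?case using module_iso_refl by (fastforce simp: Theta1_def indecomposable_def)
next
  case 7
  show ?case by (simp add: Y_module_iso_iff)
next
  case 8
  show ?case by (auto simp: upper_U_def Y_module_iso_iff)
next
  case 9
  show ?case
  \<comment> \<open>\<open>R_module a\<close> and \<open>S_module a\<close> are
    \<open>T_module a 0 1\<close> and \<open>T_module a 1 0\<close>, so the third alternative always
    holds.\<close>
  proof (intro ballI impI disjI2)
    fix M :: "'k sjp \<Rightarrow> 'k^3 \<Rightarrow> 'k^3"
    assume "M \<in> Theta2" "indecomposable M"
    then obtain a b c d e where M: "M = Theta2_module a b c d e" by (auto simp: Theta2_def)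
    with \<open>indecomposable M\<close> have "e = a" "c \<noteq> 0 \<or> d \<noteq> 0"
      by (auto simp: indecomposable_Theta2_module_iff)
    with M show "\<exists>a b c. (b \<noteq> 0 \<or> c \<noteq> 0) \<and> M \<simeq>\<^sub>M T_module a b c"
      using Theta2_module_iso_T_module by metis
  qed
next
  case 10
  show ?case by (simp add: T_module_iso_iff)
next
  case 11
  show ?case using module_iso_refl by (fastforce simp: Theta3_def indecomposable_def)
next
  case 12
  show ?case by (simp add: W_module_iso_iff)
next
  case 13
  show ?case by (auto simp: lower_U_def W_module_iso_iff)
next
  case 14
  show ?case by (intro ballI impI Theta4_normal_form)
qed

end
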